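(* Let $G = G_2(\alpha,\beta,1,0,-)$ be a metacyclic $2$-group of negative type (with $\epsilon=1$, $\delta=0$), where $\alpha\ge 3$ and $\beta\ge 3$, with generators $x,y$ as in its presentation, and let $M=\langle x,y^2\rangle$. (1) If $\alpha\ge\beta$, then $\eta(G)=\eta(M)/2+3=g_2(\alpha,\beta-1)/2+3$. (2) If $\alpha<\beta$, then $\eta(G)=\eta(M)/2+3=g_2(\alpha-1,\beta)/2+3$.
   Context: For a finite group $G$, a maximal cyclic subgroup is a cyclic subgroup not properly contained in any other cyclic subgroup, and $\eta(G)$ is the number of conjugacy classes of maximal cyclic subgroups of $G$. Write $x^y = y^{-1}xy$. For integers $\alpha,\beta>0$, $\delta\ge 0$, $\epsilon\in\{0,1\}$ with $\delta\le\beta$, $\alpha-\delta\ge 2$ and $\delta+\epsilon\le\alpha$ (and $\beta\ge\delta+1$ when $\epsilon=1$), the metacyclic $2$-group of negative type is $$G_2(\alpha,\beta,\epsilon,\delta,-)=\langle x,y \mid x^{2^\alpha}=1,\ y^{2^\beta}=x^{2^{\alpha-\epsilon}},\ x^y=x^{r}\rangle,\quad r=2^{\alpha-\delta}-1.$$ It has order $2^{\alpha+\beta}$. For positive integers $a,b$, with $k=\max(a,b)$ and $l=\min(a,b)$, set $g_2(a,b)=2^{l-1}(k-l+3)$. *)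

theory Defs
  imports Complex_Main "HOL-Algebra.Elementary_Groups"
begin

section \<open>Groups given by generators and relations\<close>

text \<open>
  A word in the generators of type \<open>'a\<close> and their inverses: the letter \<open>(a, True)\<close> stands for
  \<open>a\<close> and \<open>(a, False)\<close> for its inverse.  A relation \<open>u = v\<close> is the pair \<open>(u, v)\<close>.
\<close>

type_synonym 'a word = "('a \<times> bool) list"

definition gen :: "'a \<Rightarrow> 'a word" where
  "gen a = [(a, True)]"

definition gen_inv :: "'a \<Rightarrow> 'a word" where
  "gen_inv a = [(a, False)]"

definition word_pow :: "'a word \<Rightarrow> nat \<Rightarrow> 'a word" where
  "word_pow w n = concat (replicate n w)"

text \<open>The least congruence on words containing free cancellation and the relations \<open>R\<close>.\<close>

inductive word_eq :: "('a word \<times> 'a word) set \<Rightarrow> 'a word \<Rightarrow> 'a word \<Rightarrow> bool"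
  for R where
  refl: "word_eq R u u"
| sym: "word_eq R u v \<Longrightarrow> word_eq R v u"
| trans: "word_eq R u v \<Longrightarrow> word_eq R v w \<Longrightarrow> word_eq R u w"
| append: "word_eq R u u' \<Longrightarrow> word_eq R v v' \<Longrightarrow> word_eq R (u @ v) (u' @ v')"
| cancel: "word_eq R [(a, b), (a, \<not> b)] []"
| relation: "(u, v) \<in> R \<Longrightarrow> word_eq R u v"

definition word_class :: "('a word \<times> 'a word) set \<Rightarrow> 'a word \<Rightarrow> 'a word set" where
  "word_class R w = {v. word_eq R w v}"

definition presented_group :: "('a word \<times> 'a word) set \<Rightarrow> 'a word set monoid" where
  "presented_group R =
     \<lparr>carrier = range (word_class R),
      monoid.mult = (\<lambda>A B. \<Union>u\<in>A. \<Union>v\<in>B. word_class R (u @ v)),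
      monoid.one = word_class R []\<rparr>"

lemma word_class_eq_iff: "word_class R u = word_class R v \<longleftrightarrow> word_eq R u v"
proof
  assume "word_class R u = word_class R v"
  then have "v \<in> word_class R u"
    by (simp add: word_class_def word_eq.refl)
  then show "word_eq R u v"
    by (simp add: word_class_def)
next
  assume "word_eq R u v"
  then show "word_class R u = word_class R v"
    unfolding word_class_def by (blast intro: word_eq.trans word_eq.sym)
qed

lemma carrier_presented_group: "carrier (presented_group R) = range (word_class R)"
  by (simp add: presented_group_def)

lemma one_presented_group: "\<one>\<^bsub>presented_group R\<^esub> = word_class R []"
  by (simp add: presented_group_def)

lemma mult_presented_group:
  "word_class R u \<otimes>\<^bsub>presented_group R\<^esub> word_class R v = word_class R (u @ v)"
proof -
  have "w \<in> word_class R (u @ v)"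
    if "u' \<in> word_class R u" "v' \<in> word_class R v" "w \<in> word_class R (u' @ v')" for u' v' w
  proof -
    have "word_eq R u u'" "word_eq R v v'" "word_eq R (u' @ v') w"
      using that by (simp_all add: word_class_def)
    then have "word_eq R (u @ v) w"
      by (metis word_eq.append word_eq.trans)
    then show ?thesis
      by (simp add: word_class_def)
  qed
  moreover have "u \<in> word_class R u" "v \<in> word_class R v"
    by (simp_all add: word_class_def word_eq.refl)
  ultimately have "(\<Union>u'\<in>word_class R u. \<Union>v'\<in>word_class R v. word_class R (u' @ v')) =
      word_class R (u @ v)"
    by blast
  then show ?thesis
    by (simp add: presented_group_def)
qed

definition word_inverse :: "'a word \<Rightarrow> 'a word" where
  "word_inverse w = rev (map (\<lambda>(a, b). (a, \<not> b)) w)"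

lemma word_eq_inverse_left: "word_eq R (word_inverse w @ w) []"
proof (induction w)
  case Nil
  show ?case by (simp add: word_inverse_def word_eq.refl)
next
  case (Cons l w)
  obtain a b where l: "l = (a, b)" by (cases l)
  have "word_eq R ([(a, \<not> b), (a, b)] @ w) ([] @ w)"
    using word_eq.cancel[of R a "\<not> b"] by (intro word_eq.append word_eq.refl) simp
  then have "word_eq R (word_inverse w @ ([(a, \<not> b), (a, b)] @ w)) (word_inverse w @ w)"
    by (intro word_eq.append word_eq.refl) simp
  from word_eq.trans[OF this Cons.IH] show ?case
    by (simp add: word_inverse_def l)
qed

lemma group_presented_group: "group (presented_group R)"
proof (rule groupI)
  fix A assume "A \<in> carrier (presented_group R)"
  then obtain w where w: "A = word_class R w" by (auto simp: carrier_presented_group)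
  have "word_class R (word_inverse w) \<otimes>\<^bsub>presented_group R\<^esub> A = \<one>\<^bsub>presented_group R\<^esub>"
    by (simp add: w mult_presented_group one_presented_group word_class_eq_iff
        word_eq_inverse_left)
  then show "\<exists>B\<in>carrier (presented_group R).
      B \<otimes>\<^bsub>presented_group R\<^esub> A = \<one>\<^bsub>presented_group R\<^esub>"
    by (auto simp: carrier_presented_group)
qed (auto simp: carrier_presented_group mult_presented_group one_presented_group)

fun eval_word :: "('b, 'c) monoid_scheme \<Rightarrow> ('a \<Rightarrow> 'b) \<Rightarrow> 'a word \<Rightarrow> 'b" where
  "eval_word H f [] = \<one>\<^bsub>H\<^esub>"
| "eval_word H f ((a, b) # w) =
     (if b then f a else inv\<^bsub>H\<^esub> (f a)) \<otimes>\<^bsub>H\<^esub> eval_word H f w"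

lemma eval_word_closed:
  assumes "group H" "\<And>a. f a \<in> carrier H"
  shows "eval_word H f w \<in> carrier H"
proof -
  interpret group H by fact
  show ?thesis using assms(2) by (induction w) auto
qed

lemma eval_word_append:
  assumes "group H" "\<And>a. f a \<in> carrier H"
  shows "eval_word H f (u @ v) = eval_word H f u \<otimes>\<^bsub>H\<^esub> eval_word H f v"
proof -
  interpret group H by fact
  show ?thesis using assms
    by (induction u) (auto simp: eval_word_closed m_assoc)
qed

lemma eval_word_eq:
  assumes "group H" "\<And>a. f a \<in> carrier H"
    and "\<And>u v. (u, v) \<in> R \<Longrightarrow> eval_word H f u = eval_word H f v"
    and "word_eq R u v"
  shows "eval_word H f u = eval_word H f v"
proof -
  interpret group H by fact
  show ?thesis using assms(4)
    by (induction rule: word_eq.induct)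
       (use assms(1-3) in \<open>auto simp: eval_word_append r_inv l_inv\<close>)
qed

text \<open>The universal property of the presentation.\<close>

lemma presented_group_universal:
  assumes "group H" "\<And>a. f a \<in> carrier H"
    and "\<And>u v. (u, v) \<in> R \<Longrightarrow> eval_word H f u = eval_word H f v"
  obtains h where "h \<in> hom (presented_group R) H" "\<And>a. h (word_class R (gen a)) = f a"
proof
  define h where "h = (\<lambda>A. eval_word H f (SOME w. word_class R w = A))"
  have h: "h (word_class R w) = eval_word H f w" for w
  proof -
    have "word_class R (SOME v. word_class R v = word_class R w) = word_class R w"
      by (rule someI) (rule HOL.refl)
    then have "word_eq R (SOME v. word_class R v = word_class R w) w"
      by (simp only: word_class_eq_iff)
    from eval_word_eq[OF assms(1,2) _ this] show ?thesis
      unfolding h_def using assms(3) by simp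
  qed
  show "h \<in> hom (presented_group R) H"
    using assms(1,2)
    by (auto simp: hom_def carrier_presented_group mult_presented_group h
        eval_word_closed eval_word_append)
  interpret group H by fact
  show "h (word_class R (gen a)) = f a" for a
    using assms(2) by (simp add: h gen_def)
qed


section \<open>Metacyclic 2-groups of negative type\<close>

datatype xy = Gx | Gy

text \<open>
  The natural-number subtractions are exact in the parameter range of the family:
  \<open>\<delta> + \<epsilon> \<le> \<alpha>\<close> and \<open>\<alpha> - \<delta> \<ge> 2\<close>.
\<close>

definition G2_neg_relations :: "nat \<Rightarrow> nat \<Rightarrow> nat \<Rightarrow> nat \<Rightarrow> (xy word \<times> xy word) set" where
  "G2_neg_relations \<alpha> \<beta> \<epsilon> \<delta> =
     {(word_pow (gen Gx) (2 ^ \<alpha>), []),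
      (word_pow (gen Gy) (2 ^ \<beta>), word_pow (gen Gx) (2 ^ (\<alpha> - \<epsilon>))),
      (gen_inv Gy @ gen Gx @ gen Gy, word_pow (gen Gx) (2 ^ (\<alpha> - \<delta>) - 1))}"

definition G2_neg :: "nat \<Rightarrow> nat \<Rightarrow> nat \<Rightarrow> nat \<Rightarrow> xy word set monoid" where
  "G2_neg \<alpha> \<beta> \<epsilon> \<delta> = presented_group (G2_neg_relations \<alpha> \<beta> \<epsilon> \<delta>)"

definition G2_neg_x :: "nat \<Rightarrow> nat \<Rightarrow> nat \<Rightarrow> nat \<Rightarrow> xy word set" where
  "G2_neg_x \<alpha> \<beta> \<epsilon> \<delta> = word_class (G2_neg_relations \<alpha> \<beta> \<epsilon> \<delta>) (gen Gx)"

definition G2_neg_y :: "nat \<Rightarrow> nat \<Rightarrow> nat \<Rightarrow> nat \<Rightarrow> xy word set" where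
  "G2_neg_y \<alpha> \<beta> \<epsilon> \<delta> = word_class (G2_neg_relations \<alpha> \<beta> \<epsilon> \<delta>) (gen Gy)"


section \<open>Conjugacy classes of maximal cyclic subgroups\<close>

definition cyclic_subgroup :: "'a set \<Rightarrow> ('a, 'b) monoid_scheme \<Rightarrow> bool" where
  "cyclic_subgroup H G \<longleftrightarrow> subgroup H G \<and> cyclic_group (G\<lparr>carrier := H\<rparr>)"

definition maximal_cyclic_subgroups :: "('a, 'b) monoid_scheme \<Rightarrow> 'a set set" where
  "maximal_cyclic_subgroups G =
     {H. cyclic_subgroup H G \<and> (\<forall>K. cyclic_subgroup K G \<longrightarrow> \<not> H \<subset> K)}"

definition conj_subset :: "('a, 'b) monoid_scheme \<Rightarrow> 'a set \<Rightarrow> 'a \<Rightarrow> 'a set" where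
  "conj_subset G H g = (\<lambda>h. inv\<^bsub>G\<^esub> g \<otimes>\<^bsub>G\<^esub> h \<otimes>\<^bsub>G\<^esub> g) ` H"

definition conj_class :: "('a, 'b) monoid_scheme \<Rightarrow> 'a set \<Rightarrow> 'a set set" where
  "conj_class G H = {conj_subset G H g | g. g \<in> carrier G}"

definition eta :: "('a, 'b) monoid_scheme \<Rightarrow> nat" where
  "eta G = card (conj_class G ` maximal_cyclic_subgroups G)"

definition g2 :: "nat \<Rightarrow> nat \<Rightarrow> nat" where
  "g2 a b = (let k = max a b; l = min a b in 2 ^ (l - 1) * (k - l + 3))"

end

theory Submission
  imports Defs "HOL-Algebra.Multiplicative_Group" "HOL-Number_Theory.Cong"
begin

text \<open>
  Put \<open>a = \<alpha> - 1\<close> and \<open>b = \<beta> - 1\<close>.  In \<open>G\<close> the element \<open>y\<close> inverts \<open>x\<close>, so every element is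
  \<open>x\<^sup>i y\<^sup>j\<close>, and \<open>x\<^sup>i y\<^sup>j = 1\<close> exactly when \<open>i = 2\<^sup>a s\<close> and \<open>j = 2\<^sup>\<beta> t\<close> with \<open>s + t\<close> even.  That no
  further words are trivial is seen on words: the pair of exponents of a word, computed in the
  infinite group in which \<open>y\<close> inverts \<open>x\<close>, is constant on the classes of the presentation up to
  this lattice (\<open>exponents_word_eq\<close>).

  In a nontrivial 2-group the maximal cyclic subgroups are those generated by a nonsquare
  (\<open>two_group.maximal_cyclic_subgroups_eq\<close>), since \<open>\<langle>c\<rangle>\<close> lies properly in \<open>\<langle>d\<rangle>\<close> only if \<open>c\<close> is an even
  power of \<open>d\<close>.  A maximal cyclic subgroup of order \<open>2\<^sup>m\<close> has \<open>2\<^sup>m / 2\<close> generators, so in a finite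
  nontrivial 2-group their number is the sum of \<open>2 / ord c\<close> over all nonsquares \<open>c\<close>.

  The subgroup \<open>M\<close> consists of the elements with even \<open>y\<close>-exponent and is abelian.  A change of
  generators makes it a direct product of two cyclic groups, of orders \<open>2\<^bsup>a+1\<^esup>\<close> and \<open>2\<^sup>b\<close> or of
  orders \<open>2\<^sup>a\<close> and \<open>2\<^bsup>b+1\<^esup>\<close>, according to the larger of \<open>a\<close> and \<open>b\<close>; evaluating the weighted sum
  there gives \<open>g2\<close>.

  For \<open>G\<close> itself, an element outside \<open>M\<close> squares to an odd power of \<open>y\<^sup>2\<close>.  So the maximal cyclic
  subgroups of \<open>G\<close> are the subgroups \<open>\<langle>x\<^sup>i y\<rangle>\<close>, which form the two classes of \<open>\<langle>y\<rangle>\<close> and \<open>\<langle>x y\<rangle>\<close>, and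
  the maximal cyclic subgroups of \<open>M\<close> other than \<open>\<langle>y\<^sup>2\<rangle>\<close>.  On the latter \<open>G\<close> acts through the
  involution \<open>x\<^sup>i y\<^bsup>2j\<^esup> \<mapsto> x\<^bsup>-i\<^esup> y\<^bsup>2j\<^esup>\<close>, which fixes exactly three of them: \<open>\<langle>x\<rangle>\<close>, where it inverts,
  \<open>\<langle>x\<^sup>p y\<^sup>2\<rangle>\<close> with \<open>p = 2\<^bsup>a-1\<^esup>\<close>, where it multiplies the generators by the element of order 2, and \<open>\<langle>x y\<^sup>q\<rangle>\<close>
  with \<open>q = 2\<^sup>b\<close>, where it does both.  With \<open>n = \<eta>(M)\<close> this gives \<open>((n - 1) + 3) / 2\<close> further
  classes, and \<open>2 + (n + 2) / 2 = n / 2 + 3\<close>.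
\<close>

section \<open>Cyclic subgroups and conjugation\<close>

context group
begin

lemma mem_generate_singleton_iff:
  assumes "c \<in> carrier G"
  shows "d \<in> generate G {c} \<longleftrightarrow> (\<exists>k::int. d = c [^] k)"
  using generate_pow[OF assms] by auto

lemma generate_singleton_subset_iff:
  assumes "c \<in> carrier G" "d \<in> carrier G"
  shows "generate G {c} \<subseteq> generate G {d} \<longleftrightarrow> (\<exists>k::int. c = d [^] k)"
proof
  assume "generate G {c} \<subseteq> generate G {d}"
  then show "\<exists>k::int. c = d [^] k"
    using mem_generate_singleton_iff[OF assms(2)] generate.incl[of c "{c}" G] by auto
next
  assume "\<exists>k::int. c = d [^] k"
  then have "c \<in> generate G {d}"
    using mem_generate_singleton_iff[OF assms(2)] by auto
  then show "generate G {c} \<subseteq> generate G {d}"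
    using assms by (intro generate_subgroup_incl generate_is_subgroup) auto
qed

lemma cyclic_subgroup_iff:
  "cyclic_subgroup H G \<longleftrightarrow> (\<exists>c\<in>carrier G. H = generate G {c})"
proof
  assume *: "cyclic_subgroup H G"
  then have H: "subgroup H G" by (simp add: cyclic_subgroup_def)
  interpret H: group "G\<lparr>carrier := H\<rparr>" by (rule subgroup_imp_group[OF H])
  obtain c where c: "c \<in> H" "H = range (\<lambda>n::int. c [^]\<^bsub>G\<lparr>carrier := H\<rparr>\<^esub> n)"
    using * unfolding cyclic_subgroup_def H.cyclic_group by auto
  have "H = range (\<lambda>n::int. c [^] n)"
    using c int_pow_consistent[OF H c(1)] by simp
  moreover have "c \<in> carrier G"
    using c(1) subgroup.subset[OF H] by blast
  ultimately show "\<exists>c\<in>carrier G. H = generate G {c}"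
    using generate_pow by auto
next
  assume "\<exists>c\<in>carrier G. H = generate G {c}"
  then obtain c where c: "c \<in> carrier G" "H = generate G {c}" by blast
  have H: "subgroup H G"
    using c by (simp add: generate_is_subgroup)
  have cH: "c \<in> H"
    using c generate.incl[of c "{c}" G] by simp
  interpret H: group "G\<lparr>carrier := H\<rparr>" by (rule subgroup_imp_group[OF H])
  have "H = range (\<lambda>n::int. c [^] n)"
    using c generate_pow by auto
  then have "cyclic_group (G\<lparr>carrier := H\<rparr>)"
    unfolding H.cyclic_group using cH int_pow_consistent[OF H cH] by auto
  with H show "cyclic_subgroup H G"
    by (simp add: cyclic_subgroup_def)
qed

lemma inv_mult_cancel_left:
  assumes "c \<in> carrier G" "d \<in> carrier G"
  shows "inv c \<otimes> (c \<otimes> d) = d" "c \<otimes> (inv c \<otimes> d) = d"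
  using assms by (simp_all flip: m_assoc)

lemma conj_hom:
  assumes "g \<in> carrier G"
  shows "(\<lambda>c. inv g \<otimes> c \<otimes> g) \<in> hom G G"
proof (rule homI)
  fix c d assume "c \<in> carrier G" "d \<in> carrier G"
  then show "inv g \<otimes> (c \<otimes> d) \<otimes> g = (inv g \<otimes> c \<otimes> g) \<otimes> (inv g \<otimes> d \<otimes> g)"
    using assms by (simp add: m_assoc inv_mult_cancel_left)
qed (use assms in auto)

lemma conj_int_pow:
  assumes "g \<in> carrier G" "c \<in> carrier G"
  shows "inv g \<otimes> c [^] (i::int) \<otimes> g = (inv g \<otimes> c \<otimes> g) [^] i"
  using hom_int_pow[OF conj_hom[OF assms(1)] assms(2) is_group is_group] .

text \<open>
  Conjugation by \<open>y\<close> is an automorphism, so it sends \<open>x\<^sup>i\<close> to \<open>(x\<inverse>)\<^sup>i\<close>.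
\<close>

lemma inverting_element_int_pow:
  assumes "inv y \<otimes> x \<otimes> y = inv x" "x \<in> carrier G" "y \<in> carrier G"
  shows "y \<otimes> x [^] (i::int) = x [^] (- i) \<otimes> y" "inv y \<otimes> x [^] i = x [^] (- i) \<otimes> inv y"
proof -
  have conj: "inv y \<otimes> x [^] i \<otimes> y = x [^] (- i)" for i :: int
    unfolding conj_int_pow[OF assms(3,2)] assms(1) using assms(2) by (simp add: int_pow_inv int_pow_neg)
  have "y \<otimes> x [^] i = y \<otimes> (inv y \<otimes> x [^] (- i) \<otimes> y)"
    by (simp add: conj)
  also have "\<dots> = x [^] (- i) \<otimes> y"
    using assms by (simp add: m_assoc inv_mult_cancel_left)
  finally show "y \<otimes> x [^] i = x [^] (- i) \<otimes> y" .
  have "x [^] (- i) \<otimes> inv y = inv y \<otimes> x [^] i \<otimes> y \<otimes> inv y"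
    by (simp add: conj)
  also have "\<dots> = inv y \<otimes> x [^] i"
    using assms by (simp add: m_assoc)
  finally show "inv y \<otimes> x [^] i = x [^] (- i) \<otimes> inv y" ..
qed

lemma int_pow_commute:
  assumes "c \<otimes> d = d \<otimes> c" "c \<in> carrier G" "d \<in> carrier G"
  shows "c [^] (i::int) \<otimes> d [^] (j::int) = d [^] j \<otimes> c [^] i"
proof -
  have *: "c [^] (i::int) \<otimes> d = d \<otimes> c [^] i"
    if "c \<otimes> d = d \<otimes> c" "c \<in> carrier G" "d \<in> carrier G" for c d i
  proof -
    have "inv d \<otimes> c \<otimes> d = c"
      using that by (simp add: m_assoc inv_mult_cancel_left)
    then have "inv d \<otimes> c [^] i \<otimes> d = c [^] i"
      using conj_int_pow[of d c i] that by simp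
    then show ?thesis
      using that by (metis int_pow_closed inv_closed inv_solve_left m_assoc m_closed)
  qed
  show ?thesis
    using *[OF _ assms(3), of "c [^] i" j] *[OF assms] * assms by (metis int_pow_closed)
qed

lemma conj_subset_generate:
  assumes "g \<in> carrier G" "c \<in> carrier G"
  shows "conj_subset G (generate G {c}) g = generate G {inv g \<otimes> c \<otimes> g}"
proof -
  have "conj_subset G (generate G {c}) g = range (\<lambda>k::int. inv g \<otimes> c [^] k \<otimes> g)"
    unfolding conj_subset_def generate_pow[OF assms(2)] by auto
  also have "\<dots> = range (\<lambda>k::int. (inv g \<otimes> c \<otimes> g) [^] k)"
    by (simp only: conj_int_pow[OF assms])
  also have "\<dots> = generate G {inv g \<otimes> c \<otimes> g}"
    using generate_pow[of "inv g \<otimes> c \<otimes> g"] assms by auto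
  finally show ?thesis .
qed

lemma conj_subset_conj_subset:
  assumes "g \<in> carrier G" "h \<in> carrier G" "H \<subseteq> carrier G"
  shows "conj_subset G (conj_subset G H g) h = conj_subset G H (g \<otimes> h)"
  unfolding conj_subset_def image_image
  using assms by (intro image_cong) (auto simp: inv_mult_group m_assoc subset_iff)

lemma conj_subset_one:
  assumes "H \<subseteq> carrier G"
  shows "conj_subset G H \<one> = H"
proof -
  have "conj_subset G H \<one> = (\<lambda>h. h) ` H"
    unfolding conj_subset_def using assms by (intro image_cong) auto
  then show ?thesis by simp
qed

lemma self_in_conj_class:
  assumes "H \<subseteq> carrier G"
  shows "H \<in> conj_class G H"
  unfolding conj_class_def using conj_subset_one[OF assms] by force

lemma conj_class_conj_subset:
  assumes "g \<in> carrier G" "H \<subseteq> carrier G"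
  shows "conj_class G (conj_subset G H g) = conj_class G H"
proof (intro equalityI subsetI)
  fix K assume "K \<in> conj_class G (conj_subset G H g)"
  then obtain h where "h \<in> carrier G" "K = conj_subset G H (g \<otimes> h)"
    unfolding conj_class_def using conj_subset_conj_subset assms by auto
  then show "K \<in> conj_class G H"
    unfolding conj_class_def using assms by blast
next
  fix K assume "K \<in> conj_class G H"
  then obtain h where h: "h \<in> carrier G" "K = conj_subset G H h"
    unfolding conj_class_def by auto
  then have "K = conj_subset G (conj_subset G H g) (inv g \<otimes> h)"
    using assms by (simp add: conj_subset_conj_subset m_assoc[symmetric])
  then show "K \<in> conj_class G (conj_subset G H g)"
    unfolding conj_class_def using assms h by blast
qed

end

section \<open>Maximal cyclic subgroups of 2-groups\<close>

definition nonsquares :: "('a, 'b) monoid_scheme \<Rightarrow> 'a set" where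
  "nonsquares G = carrier G - (\<lambda>d. d \<otimes>\<^bsub>G\<^esub> d) ` carrier G"

locale two_group = group +
  assumes torsion: "c \<in> carrier G \<Longrightarrow> \<exists>m. c [^] (2 ^ m :: nat) = \<one>"
begin

lemma ord_eq_pow2:
  assumes "c \<in> carrier G"
  obtains m where "ord c = 2 ^ m"
proof -
  obtain m where "c [^] (2 ^ m :: nat) = \<one>"
    using torsion assms by blast
  then have "ord c dvd 2 ^ m"
    using pow_eq_id assms by blast
  then show ?thesis
    using divides_primepow_nat[of 2 "ord c" m] that by auto
qed

text \<open>
  An odd \<open>k\<close> is invertible modulo the order of \<open>c\<close>, which is a power of 2.
\<close>

lemma odd_power_invertible:
  assumes "c \<in> carrier G" "odd (k :: int)"
  obtains l :: int where "(c [^] k) [^] l = c"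
proof -
  obtain m where m: "ord c = 2 ^ m"
    using ord_eq_pow2 assms by blast
  have "coprime k (2 ^ m)"
    using assms(2) by simp
  then obtain l where "[k * l = 1] (mod 2 ^ m)"
    using cong_solve_coprime_int by blast
  then have "int (ord c) dvd 1 - k * l"
    using m by (simp add: cong_iff_dvd_diff dvd_diff_commute)
  then have "(c [^] k) [^] l = c"
    using int_pow_eq[OF assms(1), of "k * l" 1] assms by (simp add: int_pow_pow)
  then show ?thesis
    using that by blast
qed

text \<open>
  If \<open>c = c\<^bsup>kl\<^esup>\<close>, the order of \<open>c\<close> divides \<open>1 - kl\<close>, which is odd for even \<open>k\<close>.  Hence no
  nontrivial element lies in the subgroup generated by one of its even powers.
\<close>

lemma even_power_inverse_trivial:
  assumes "c \<in> carrier G" "even (k :: int)" "c = (c [^] k) [^] (l :: int)"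
  shows "c = \<one>"
proof -
  obtain m where m: "ord c = 2 ^ m"
    using ord_eq_pow2 assms by blast
  have "c [^] (k * l) = c [^] (1::int)"
    using assms by (simp add: int_pow_pow)
  then have "int (ord c) dvd 1 - k * l"
    using int_pow_eq[OF assms(1)] by blast
  moreover have "odd (1 - k * l)"
    using assms(2) by simp
  ultimately have "odd (int (ord c))"
    using dvd_trans by blast
  then have "ord c = 1"
    using m by (cases m) auto
  then show ?thesis
    using ord_eq_1 assms by blast
qed

text \<open>
  Odd powers can be undone.  Conversely, if each of \<open>c\<close> and \<open>d\<close> is a power of the other and the
  exponent is even, both are trivial, and then the odd exponent 1 serves as well.
\<close>

lemma generate_eq_iff:
  assumes "c \<in> carrier G" "d \<in> carrier G"
  shows "generate G {c} = generate G {d} \<longleftrightarrow> (\<exists>k::int. odd k \<and> d = c [^] k)"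
proof
  assume eq: "generate G {c} = generate G {d}"
  have "generate G {d} \<subseteq> generate G {c}" "generate G {c} \<subseteq> generate G {d}"
    using eq by (auto simp only:)
  then have "\<exists>k::int. d = c [^] k" "\<exists>l::int. c = d [^] l"
    by (simp_all only: generate_singleton_subset_iff assms)
  then obtain k l :: int where k: "d = c [^] k" and l: "c = d [^] l"
    by (elim exE)
  show "\<exists>k::int. odd k \<and> d = c [^] k"
  proof (cases "odd k")
    case False
    then have "c = \<one>"
      using even_power_inverse_trivial[OF assms(1) _ l[unfolded k]] by blast
    then have "d = c [^] (1::int)"
      using k by simp
    then show ?thesis by (metis odd_one)
  qed (use k in blast)
next
  assume "\<exists>k::int. odd k \<and> d = c [^] k"
  then obtain k :: int where k: "odd k" "d = c [^] k" by blast
  obtain l :: int where "(c [^] k) [^] l = c"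
    using odd_power_invertible[OF assms(1) k(1)] by blast
  then have l: "c = d [^] l"
    using k(2) by simp
  show "generate G {c} = generate G {d}"
    using generate_singleton_subset_iff[OF assms(1,2), THEN iffD2, OF exI, OF l]
      generate_singleton_subset_iff[OF assms(2,1), THEN iffD2, OF exI, OF k(2)]
    by (rule equalityI)
qed

text \<open>
  If \<open>c\<^sup>k\<close> is a square, so is each of its powers, and \<open>c\<close> is one of them.
\<close>

lemma odd_power_nonsquare:
  assumes "c \<in> nonsquares G" "odd (k :: int)"
  shows "c [^] k \<in> nonsquares G"
proof -
  have c: "c \<in> carrier G"
    using assms by (simp add: nonsquares_def)
  obtain l :: int where l: "(c [^] k) [^] l = c"
    using odd_power_invertible[OF c assms(2)] by blast
  have False if "e \<in> carrier G" "c [^] k = e \<otimes> e" for e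
  proof -
    have "c = e [^] l \<otimes> e [^] l"
      using that l int_pow_mult_distrib[of e e l] by simp
    then show False
      using assms(1) that by (auto simp: nonsquares_def)
  qed
  then show ?thesis
    using c by (auto simp: nonsquares_def)
qed

text \<open>
  A cyclic subgroup \<open>\<langle>d\<rangle>\<close> containing \<open>c = d\<^sup>k\<close> equals \<open>\<langle>c\<rangle>\<close> for odd \<open>k\<close>, while for even \<open>k\<close> the element
  \<open>c\<close> is a square.  Conversely a square \<open>d\<^sup>2\<close> generates a proper subgroup of \<open>\<langle>d\<rangle>\<close> unless \<open>d\<close> is trivial;
  nontriviality of the group covers this last case, as the trivial element is a square too.
\<close>

lemma maximal_cyclic_subgroups_eq:
  assumes "\<exists>e\<in>carrier G. e \<noteq> \<one>"
  shows "maximal_cyclic_subgroups G = (\<lambda>c. generate G {c}) ` nonsquares G"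
proof -
  have "(\<forall>K. cyclic_subgroup K G \<longrightarrow> \<not> generate G {c} \<subset> K) \<longleftrightarrow> c \<in> nonsquares G"
    if c: "c \<in> carrier G" for c
  proof
    assume max: "\<forall>K. cyclic_subgroup K G \<longrightarrow> \<not> generate G {c} \<subset> K"
    show "c \<in> nonsquares G"
    proof (rule ccontr)
      assume "c \<notin> nonsquares G"
      then obtain d where d: "d \<in> carrier G" "c = d \<otimes> d"
        using c by (auto simp: nonsquares_def)
      obtain d' where d': "d' \<in> carrier G" "d' \<noteq> \<one>" "\<exists>k::int. even k \<and> c = d' [^] k"
      proof (cases "d = \<one>")
        case True
        obtain e where e: "e \<in> carrier G" "e \<noteq> \<one>"
          using assms by blast
        moreover have "c = e [^] (0::int)"
          using True d by simp
        ultimately show ?thesis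
          using that by (metis even_zero)
      next
        case False
        have "c = d [^] (2::int)"
          using d int_pow_mult[OF d(1), of 1 1] by simp
        then show ?thesis
          using that[of d] d False by (metis even_numeral)
      qed
      then obtain k :: int where k: "even k" "c = d' [^] k" by blast
      have "generate G {c} \<subseteq> generate G {d'}"
        using generate_singleton_subset_iff[OF c d'(1)] k by blast
      then have "generate G {d'} \<subseteq> generate G {c}"
        using max cyclic_subgroup_iff d'(1) by blast
      then obtain l :: int where "d' = c [^] l"
        using generate_singleton_subset_iff[OF d'(1) c] by blast
      then have "d' = (d' [^] k) [^] l"
        using k by simp
      then have "d' = \<one>"
        using even_power_inverse_trivial k d' by blast
      with d' show False by simp
    qed
  next
    assume ns: "c \<in> nonsquares G"
    show "\<forall>K. cyclic_subgroup K G \<longrightarrow> \<not> generate G {c} \<subset> K"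
    proof (intro allI impI notI)
      fix K assume "cyclic_subgroup K G" "generate G {c} \<subset> K"
      then obtain d where d: "d \<in> carrier G" "generate G {c} \<subset> generate G {d}"
        using cyclic_subgroup_iff by auto
      then obtain k :: int where k: "c = d [^] k"
        using generate_singleton_subset_iff[OF c d(1)] by blast
      show False
      proof (cases "even k")
        case True
        then obtain h where "k = h + h"
          by (metis evenE mult_2)
        then have "c = d [^] h \<otimes> d [^] h"
          using d k by (simp only: int_pow_mult)
        then show False
          using ns d by (auto simp: nonsquares_def)
      next
        case False
        then have "generate G {d} = generate G {c}"
          using generate_eq_iff[OF d(1) c] k by blast
        then show False
          using d(2) by blast
      qed
    qed
  qed
  then show ?thesis
    unfolding maximal_cyclic_subgroups_def cyclic_subgroup_iff
    by (auto simp: nonsquares_def)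
qed

text \<open>
  The generators of a cyclic group of order \<open>2\<^bsup>m+1\<^esup>\<close> are the \<open>2\<^sup>m\<close> odd powers of any one of them.
  So the nonsquares generating a given maximal cyclic subgroup have weights \<open>2 / ord c\<close> that add up to 1.
\<close>

lemma card_maximal_cyclic_subgroups:
  assumes "\<exists>e\<in>carrier G. e \<noteq> \<one>" and fin: "finite (carrier G)"
  shows "real (card (maximal_cyclic_subgroups G)) = (\<Sum>c\<in>nonsquares G. 2 / real (ord c))"
proof -
  let ?gen = "\<lambda>c. generate G {c}"
  have finN: "finite (nonsquares G)"
    using fin by (simp add: nonsquares_def)
  have one: "(\<Sum>d\<in>{d \<in> nonsquares G. ?gen d = H}. 2 / real (ord d)) = 1"
    if H: "H \<in> ?gen ` nonsquares G" for H
  proof -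
    obtain c where c: "c \<in> nonsquares G" "H = ?gen c"
      using H by blast
    then have cG: "c \<in> carrier G" "c \<noteq> \<one>"
      by (auto simp: nonsquares_def intro!: image_eqI[of _ _ \<one>])
    obtain m' where m': "ord c = 2 ^ m'"
      using ord_eq_pow2 cG by blast
    then obtain m where m: "ord c = 2 ^ Suc m"
      using cG ord_eq_1[of c] by (cases m') auto
    have fib: "{d \<in> nonsquares G. ?gen d = H} = (\<lambda>s. c [^] (2 * s + 1 :: nat)) ` {..<2 ^ m}"
    proof (intro equalityI subsetI)
      fix d assume "d \<in> {d \<in> nonsquares G. ?gen d = H}"
      then obtain k :: int where k: "odd k" "d = c [^] k"
        using generate_eq_iff[of c d] cG c by (auto simp: nonsquares_def)
      define r where "r = k mod 2 ^ Suc m"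
      have "odd r"
        using k by (simp add: r_def dvd_mod_iff)
      moreover have "0 \<le> r" "r < 2 ^ Suc m"
        by (simp_all add: r_def)
      ultimately obtain s where s: "r = 2 * s + 1" "0 \<le> s" "s < 2 ^ m"
        by (auto elim!: oddE)
      have "c [^] k = c [^] r"
        using int_pow_eq[OF cG(1), of k r] m by (simp add: r_def mod_eq_dvd_iff[symmetric])
      also have "r = int (2 * nat s + 1)"
        using s by simp
      finally have "d = c [^] (2 * nat s + 1)"
        using k by (simp only: int_pow_int)
      moreover have "nat s < 2 ^ m"
        using s by (simp add: nat_less_iff)
      ultimately show "d \<in> (\<lambda>s. c [^] (2 * s + 1 :: nat)) ` {..<2 ^ m}"
        by blast
    next
      fix d assume "d \<in> (\<lambda>s. c [^] (2 * s + 1 :: nat)) ` {..<2 ^ m}"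
      then obtain s where "d = c [^] int (2 * s + 1)"
        by (auto simp only: int_pow_int)
      then obtain k :: int where k: "odd k" "d = c [^] k"
        using that[of "int (2 * s + 1)"] by simp
      then have "?gen c = ?gen d"
        using generate_eq_iff[OF cG(1)] cG(1) by blast
      then show "d \<in> {d \<in> nonsquares G. ?gen d = H}"
        using odd_power_nonsquare[OF c(1) k(1)] c(2) k(2) by simp
    qed
    have inj: "inj_on (\<lambda>s. c [^] (2 * s + 1 :: nat)) {..<2 ^ m}"
    proof (rule inj_onI)
      fix s t :: nat assume st: "s \<in> {..<2 ^ m}" "t \<in> {..<2 ^ m}"
        and "c [^] (2 * s + 1) = c [^] (2 * t + 1)"
      then have "c [^] int (2 * s + 1) = c [^] int (2 * t + 1)"
        by (simp only: int_pow_int)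
      then have "int (2 ^ Suc m) dvd int (2 * t + 1) - int (2 * s + 1)"
        using int_pow_eq[OF cG(1)] m by metis
      then have "[2 * t + 1 = 2 * s + 1] (mod 2 ^ Suc m)"
        by (metis cong_iff_dvd_diff cong_int_iff)
      then show "s = t"
        using st cong_less_modulus_unique_nat[of "2 * t + 1" "2 * s + 1" "2 ^ Suc m"] by simp
    qed
    have "ord d = ord c" if "d \<in> {d \<in> nonsquares G. ?gen d = H}" for d
      using that c cG generate_pow_card by (auto simp: nonsquares_def)
    then have "(\<Sum>d\<in>{d \<in> nonsquares G. ?gen d = H}. 2 / real (ord d))
        = (\<Sum>d\<in>{d \<in> nonsquares G. ?gen d = H}. 2 / 2 ^ Suc m)"
      using m by (intro sum.cong) auto
    also have "\<dots> = real (card {d \<in> nonsquares G. ?gen d = H}) / 2 ^ m"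
      by simp
    also have "card {d \<in> nonsquares G. ?gen d = H} = 2 ^ m"
      by (simp only: fib card_image[OF inj] card_lessThan)
    finally show ?thesis by simp
  qed
  have "(\<Sum>c\<in>nonsquares G. 2 / real (ord c)) =
      (\<Sum>H\<in>?gen ` nonsquares G. \<Sum>d\<in>{d \<in> nonsquares G. ?gen d = H}. 2 / real (ord d))"
    using finN by (subst sum.group) auto
  also have "\<dots> = (\<Sum>H\<in>?gen ` nonsquares G. 1)"
    using one by (rule sum.cong[OF HOL.refl])
  also have "\<dots> = real (card (maximal_cyclic_subgroups G))"
    by (simp add: maximal_cyclic_subgroups_eq[OF assms(1)])
  finally show ?thesis by simp
qed

end

lemma (in comm_group) eta_eq_card_maximal_cyclic_subgroups:
  "eta G = card (maximal_cyclic_subgroups G)"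
proof -
  have "conj_class G H = {H}" if "H \<in> maximal_cyclic_subgroups G" for H
  proof -
    have H: "H \<subseteq> carrier G"
      using that subgroup.subset by (auto simp: maximal_cyclic_subgroups_def cyclic_subgroup_def)
    have "inv g \<otimes> h \<otimes> g = h" if "g \<in> carrier G" "h \<in> H" for g h
      using that H m_comm m_assoc inv_solve_left by (metis inv_closed m_closed subsetD)
    then have "conj_subset G H g = H" if "g \<in> carrier G" for g
      unfolding conj_subset_def using that by simp
    then show ?thesis
      unfolding conj_class_def by auto
  qed
  then have "conj_class G ` maximal_cyclic_subgroups G = (\<lambda>H. {H}) ` maximal_cyclic_subgroups G"
    by auto
  then show ?thesis
    by (simp add: eta_def card_image)
qed

section \<open>Abelian 2-groups of rank two\<close>

lemma sum_lessThan_double: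
  fixes f :: "nat \<Rightarrow> real"
  shows "(\<Sum>i<2 * n. f i) = (\<Sum>i<n. f (2 * i)) + (\<Sum>i<n. f (2 * i + 1))"
  using sum_split_even_odd[of f f n] by (simp only: if_cancel)

text \<open>
  The quotient \<open>2\<^sup>n div gcd i (2\<^sup>n)\<close> is the order of \<open>i\<close> in \<open>\<int>/2\<^sup>n\<close>.  From \<open>n\<close> to \<open>n + 1\<close> the even
  residues reproduce the previous sum, and the \<open>2\<^sup>n\<close> odd ones, of order \<open>2\<^bsup>n+1\<^esup>\<close>, contribute
  \<open>1/2\<close>.  The formula already holds for \<open>n = l - 1\<close>, where every maximum is \<open>2\<^sup>l\<close>; this start makes the
  case \<open>k = l\<close> below uniform with the others.
\<close>

lemma sum_inverse_max_order:
  assumes "l \<ge> 1" "l \<le> n + 1"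
  shows "(\<Sum>i<(2::nat) ^ n. 1 / real (max (2 ^ l) (2 ^ n div gcd i (2 ^ n)))) = 1 + (real n - real l) / 2"
  using assms(2)
proof (induction n)
  case 0
  then have "l = 1" using assms(1) by simp
  then show ?case by simp
next
  case (Suc n)
  show ?case
  proof (cases "l = Suc n + 1")
    case True
    have "max (2 ^ l) (2 ^ Suc n div gcd i (2 ^ Suc n)) = (2 ^ l :: nat)" for i
    proof -
      have "2 ^ Suc n div gcd i (2 ^ Suc n) \<le> (2 ^ Suc n :: nat)" by simp
      also have "\<dots> \<le> 2 ^ l" using True by (intro power_increasing) auto
      finally show ?thesis by simp
    qed
    then show ?thesis using True by simp
  next
    case False
    then have l: "l \<le> Suc n" using Suc.prems by simp
    let ?f = "\<lambda>i. 1 / real (max (2 ^ l) (2 ^ Suc n div gcd i (2 ^ Suc n)))"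
    have ev: "?f (2 * i) = 1 / real (max (2 ^ l) (2 ^ n div gcd i (2 ^ n)))" for i
      by (simp flip: gcd_mult_distrib_nat)
    have od: "?f (2 * i + 1) = 1 / 2 ^ Suc n" for i
    proof -
      have "coprime (2 * i + 1) (2 ^ Suc n)"
        by simp
      then have "gcd (2 * i + 1) (2 ^ Suc n) = 1"
        by (simp only: coprime_iff_gcd_eq_1)
      moreover have "(2 ^ l :: nat) \<le> 2 ^ Suc n"
        using l by (intro power_increasing) auto
      ultimately show ?thesis by (simp add: max_def del: power_Suc)
    qed
    have "(\<Sum>i<2 ^ Suc n. ?f i) = (\<Sum>i<2 ^ n. ?f (2 * i)) + (\<Sum>i<2 ^ n. ?f (2 * i + 1))"
      by (simp only: power_Suc sum_lessThan_double)
    also have "\<dots> = 1 + (real n - real l) / 2 + 1 / 2"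
      using Suc.IH l by (simp only: ev od) simp
    finally show ?thesis by (simp add: field_simps)
  qed
qed

text \<open>
  The internal direct product of \<open>\<langle>u\<rangle>\<close>, of order \<open>2\<^sup>k\<close>, and \<open>\<langle>v\<rangle>\<close>, of order \<open>2\<^sup>l\<close>, ordered by
  \<open>l \<le> k\<close>.
\<close>

locale rank_two_group = comm_group +
  fixes u v :: 'a and k l :: nat
  assumes u_closed [simp]: "u \<in> carrier G" and v_closed [simp]: "v \<in> carrier G"
    and l_pos: "1 \<le> l" and l_le_k: "l \<le> k"
    and spanned: "g \<in> carrier G \<Longrightarrow> \<exists>(i::int) (j::int). g = u [^] i \<otimes> v [^] j"
    and independent: "\<And>(i::int) (j::int). u [^] i \<otimes> v [^] j = \<one> \<longleftrightarrow> 2 ^ k dvd i \<and> 2 ^ l dvd j"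
begin

lemma power_eq_iff:
  "u [^] (i::int) \<otimes> v [^] (j::int) = u [^] (i'::int) \<otimes> v [^] (j'::int) \<longleftrightarrow>
    2 ^ k dvd i - i' \<and> 2 ^ l dvd j - j'"
proof -
  have "(u [^] i \<otimes> v [^] j) \<otimes> inv (u [^] i' \<otimes> v [^] j') = u [^] (i - i') \<otimes> v [^] (j - j')"
    by (simp add: int_pow_diff inv_mult m_ac)
  then show ?thesis
    using independent[of "i - i'" "j - j'"]
    by (metis inv_closed inv_inv inv_equality m_closed int_pow_closed r_inv u_closed v_closed)
qed

sublocale two_group
proof
  fix c assume "c \<in> carrier G"
  then obtain i j :: int where c: "c = u [^] i \<otimes> v [^] j"
    using spanned by blast
  have "c [^] (2 ^ (k + l) :: int) = u [^] (i * 2 ^ (k + l)) \<otimes> v [^] (j * 2 ^ (k + l))"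
    by (simp add: c int_pow_distrib int_pow_pow)
  also have "\<dots> = \<one>"
    by (simp add: independent power_add)
  finally have "c [^] int (2 ^ (k + l)) = \<one>"
    by simp
  then show "\<exists>m. c [^] (2 ^ m :: nat) = \<one>"
    unfolding int_pow_int by blast
qed

abbreviation pt :: "nat \<times> nat \<Rightarrow> 'a" where
  "pt \<equiv> \<lambda>(i, j). u [^] int i \<otimes> v [^] int j"

lemma pt_closed [simp]: "pt p \<in> carrier G"
  by (simp add: case_prod_beta)

lemma bij_betw_pt: "bij_betw pt ({..<2 ^ k} \<times> {..<2 ^ l}) (carrier G)"
proof (rule bij_betw_imageI)
  show "inj_on pt ({..<2 ^ k} \<times> {..<2 ^ l})"
  proof (rule inj_onI, clarify)
    fix i j i' j' :: nat
    assume "i < 2 ^ k" "i' < 2 ^ k" "j < 2 ^ l" "j' < 2 ^ l"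
      and "u [^] int i \<otimes> v [^] int j = u [^] int i' \<otimes> v [^] int j'"
    moreover from this have "[int i = int i'] (mod int (2 ^ k))" "[int j = int j'] (mod int (2 ^ l))"
      by (simp_all add: power_eq_iff cong_iff_dvd_diff)
    ultimately show "i = i' \<and> j = j'"
      using cong_less_modulus_unique_nat cong_int_iff by blast
  qed
  show "pt ` ({..<2 ^ k} \<times> {..<2 ^ l}) = carrier G"
  proof (intro equalityI subsetI)
    fix g assume "g \<in> carrier G"
    then obtain i j :: int where g: "g = u [^] i \<otimes> v [^] j"
      using spanned by blast
    have "g = u [^] (i mod 2 ^ k) \<otimes> v [^] (j mod 2 ^ l)"
      unfolding g power_eq_iff by (simp add: mod_eq_dvd_iff[symmetric])
    then have "g = pt (nat (i mod 2 ^ k), nat (j mod 2 ^ l))"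
      by simp
    moreover have "nat (i mod 2 ^ k) < 2 ^ k" "nat (j mod 2 ^ l) < 2 ^ l"
      by (simp_all add: nat_less_iff)
    ultimately show "g \<in> pt ` ({..<2 ^ k} \<times> {..<2 ^ l})"
      by blast
  qed (use pt_closed in blast)
qed

lemma pt_nonsquare_iff: "pt (i, j) \<in> nonsquares G \<longleftrightarrow> odd i \<or> odd j"
proof -
  have "(\<exists>d\<in>carrier G. pt (i, j) = d \<otimes> d) \<longleftrightarrow> even i \<and> even j"
  proof
    assume "\<exists>d\<in>carrier G. pt (i, j) = d \<otimes> d"
    then obtain m n :: int where
      "pt (i, j) = (u [^] m \<otimes> v [^] n) \<otimes> (u [^] m \<otimes> v [^] n)"
      using spanned by blast
    also have "\<dots> = u [^] (m + m) \<otimes> v [^] (n + n)"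
      by (simp only: int_pow_mult u_closed v_closed) (simp add: m_ac)
    finally have "2 ^ k dvd int i - (m + m)" "2 ^ l dvd int j - (n + n)"
      by (simp_all add: power_eq_iff)
    moreover have "(2::int) dvd 2 ^ k" "(2::int) dvd 2 ^ l"
      using l_pos l_le_k by simp_all
    ultimately have "even (int i - (m + m))" "even (int j - (n + n))"
      by (meson dvd_trans)+
    then show "even i \<and> even j" by simp
  next
    assume "even i \<and> even j"
    then obtain m n where "i = m + m" "j = n + n"
      by (metis evenE mult_2)
    then have "pt (i, j) = (u [^] int m \<otimes> u [^] int m) \<otimes> (v [^] int n \<otimes> v [^] int n)"
      by (simp only: prod.case of_nat_add int_pow_mult u_closed v_closed)
    then have "pt (i, j) = pt (m, n) \<otimes> pt (m, n)"
      by (simp add: m_ac)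
    then show "\<exists>d\<in>carrier G. pt (i, j) = d \<otimes> d"
      using pt_closed by blast
  qed
  then show ?thesis
    using pt_closed[of "(i, j)"] by (auto simp: nonsquares_def)
qed

lemma ord_pt_iff: "ord (pt (i, j)) dvd n \<longleftrightarrow> 2 ^ k dvd i * n \<and> 2 ^ l dvd j * n"
proof -
  have "pt (i, j) [^] n = pt (i, j) [^] int n"
    by (simp only: int_pow_int)
  also have "\<dots> = u [^] (int i * int n) \<otimes> v [^] (int j * int n)"
    by (simp add: int_pow_distrib int_pow_pow)
  finally have "pt (i, j) [^] n = \<one> \<longleftrightarrow> int (2 ^ k) dvd int (i * n) \<and> int (2 ^ l) dvd int (j * n)"
    by (simp add: independent)
  then show ?thesis
    by (simp only: pow_eq_id[OF pt_closed] int_dvd_int_iff)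
qed

text \<open>
  The first component has the full order \<open>2\<^sup>k\<close>, which the order of the second divides because
  \<open>l \<le> k\<close>.
\<close>

lemma ord_pt_odd:
  assumes "odd i"
  shows "ord (pt (i, j)) = 2 ^ k"
proof -
  have "2 ^ l dvd (2 ^ k :: nat)"
    using l_le_k by (rule le_imp_power_dvd)
  moreover have "coprime (2 ^ k) i"
    using assms by simp
  ultimately have "ord (pt (i, j)) dvd n \<longleftrightarrow> 2 ^ k dvd n" for n
    unfolding ord_pt_iff by (auto simp: coprime_dvd_mult_right_iff intro: dvd_trans)
  then show ?thesis
    by (meson dvd_antisym dvd_refl)
qed

text \<open>
  The second component has order \<open>2\<^sup>l\<close>, and the first, \<open>u\<^bsup>2i\<^esup>\<close>, has the order of \<open>i\<close> in
  \<open>\<int>/2\<^bsup>k-1\<^esup>\<close>.  For powers of 2 the least common multiple is the maximum.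
\<close>

lemma ord_pt_even_odd:
  assumes "odd j"
  shows "ord (pt (2 * i, j)) = max (2 ^ l) (2 ^ (k - 1) div gcd i (2 ^ (k - 1)))"
    (is "_ = max _ ?q")
proof -
  have "?q dvd 2 ^ (k - 1)"
    by (metis dvd_div_mult_self dvd_triv_left gcd_dvd2)
  then obtain q where q: "?q = 2 ^ q"
    using divides_primepow_nat[of 2 ?q "k - 1"] by auto
  have "2 ^ k dvd 2 * i * n \<longleftrightarrow> ?q dvd n" for n
  proof -
    have "(2 ^ k :: nat) = 2 * 2 ^ (k - 1)"
      using l_pos l_le_k by (cases k) auto
    then have "2 ^ k dvd 2 * i * n \<longleftrightarrow> 2 ^ (k - 1) dvd i * n"
      by (simp add: mult.assoc)
    also have "\<dots> \<longleftrightarrow> ?q * gcd i (2 ^ (k - 1)) dvd (i div gcd i (2 ^ (k - 1))) * n * gcd i (2 ^ (k - 1))"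
      by (simp add: mult.commute mult.left_commute)
    also have "\<dots> \<longleftrightarrow> ?q dvd (i div gcd i (2 ^ (k - 1))) * n"
      by (subst dvd_times_right_cancel_iff) auto
    also have "\<dots> \<longleftrightarrow> ?q dvd n"
    proof -
      have "coprime ?q (i div gcd i (2 ^ (k - 1)))"
        using div_gcd_coprime[of i "2 ^ (k - 1)"] by (simp add: coprime_commute)
      then show ?thesis
        by (rule coprime_dvd_mult_right_iff)
    qed
    finally show ?thesis .
  qed
  moreover have "2 ^ l dvd j * n \<longleftrightarrow> 2 ^ l dvd n" for n
    using assms by (intro coprime_dvd_mult_right_iff) simp
  ultimately have "ord (pt (2 * i, j)) dvd n \<longleftrightarrow> 2 ^ l dvd n \<and> 2 ^ q dvd n" for n
    unfolding ord_pt_iff q by blast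
  also have "2 ^ l dvd n \<and> 2 ^ q dvd n \<longleftrightarrow> max (2 ^ l) (2 ^ q) dvd n" for n :: nat
  proof (cases "l \<le> q")
    case True
    then have "2 ^ l dvd (2 ^ q :: nat)" by (rule le_imp_power_dvd)
    then show ?thesis using True by (auto simp: max_def intro: dvd_trans)
  next
    case False
    then have "2 ^ q dvd (2 ^ l :: nat)" by (intro le_imp_power_dvd) simp
    then show ?thesis using False by (auto simp: max_def intro: dvd_trans)
  qed
  finally show ?thesis
    unfolding q by (meson dvd_antisym dvd_refl)
qed

text \<open>
  The weights \<open>2 / ord c\<close> are summed in coordinates.  The points with odd \<open>i\<close> contribute \<open>2\<^sup>l\<close>
  altogether.  Those with \<open>i\<close> even and \<open>j\<close> odd contribute \<open>2\<^sup>l\<close> times the sum of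
  \<open>sum_inverse_max_order\<close> for \<open>n = k - 1\<close>, that is \<open>2\<^sup>l (1 + (k - 1 - l) / 2)\<close>.
\<close>

lemma card_maximal_cyclic_subgroups_rank_two:
  "card (maximal_cyclic_subgroups G) = 2 ^ (l - 1) * (k - l + 3)"
proof -
  let ?N = "\<lambda>i j. if odd i \<or> odd j then 2 / real (ord (pt (i, j))) else 0"
  let ?h = "2 ^ (k - 1) :: nat"
  have k2: "(2::nat) ^ k = 2 * ?h" and l2: "(2::nat) ^ l = 2 * 2 ^ (l - 1)"
    using l_pos l_le_k by (simp_all flip: power_Suc)
  have k2': "(2::real) ^ k = 2 * 2 ^ (k - 1)" and l2': "(2::real) ^ l = 2 * 2 ^ (l - 1)"
    using l_pos l_le_k by (simp_all flip: power_Suc)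
  have fin: "finite (carrier G)"
    using bij_betw_finite[OF bij_betw_pt] by simp
  have nontriv: "\<exists>e\<in>carrier G. e \<noteq> \<one>"
  proof
    have "odd (1::nat)" by simp
    then show "pt (1, 0) \<noteq> \<one>"
      using pt_nonsquare_iff[of 1 0] by (auto simp: nonsquares_def intro!: image_eqI[of _ _ \<one>])
  qed simp
  have even_sum: "(\<Sum>j<2 ^ l. ?N (2 * i) j) = 2 ^ l * (1 / real (max (2 ^ l) (?h div gcd i ?h)))" for i
  proof -
    have "?N (2 * i) (2 * j) = 0" for j
      by simp
    moreover have "?N (2 * i) (2 * j + 1) = 2 / real (max (2 ^ l) (?h div gcd i ?h))" for j
    proof -
      have "odd (2 * j + 1)" by simp
      then show ?thesis
        by (simp only: ord_pt_even_odd if_True simp_thms)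
    qed
    ultimately have "(\<Sum>j<2 * 2 ^ (l - 1). ?N (2 * i) j)
        = real (2 * 2 ^ (l - 1)) * (1 / real (max (2 ^ l) (?h div gcd i ?h)))"
      unfolding sum_lessThan_double by simp
    then show ?thesis
      unfolding l2[symmetric] by simp
  qed
  have odd_sum: "(\<Sum>j<2 ^ l. ?N (2 * i + 1) j) = 2 ^ l * (2 / 2 ^ k)" for i
  proof -
    have "odd (2 * i + 1)" by simp
    then have "?N (2 * i + 1) j = 2 / 2 ^ k" for j
      by (simp only: ord_pt_odd if_True simp_thms of_nat_power of_nat_numeral)
    then show ?thesis by simp
  qed
  have "nonsquares G = {c \<in> carrier G. c \<in> nonsquares G}"
    by (auto simp: nonsquares_def)
  then have "real (card (maximal_cyclic_subgroups G)) =
      (\<Sum>c\<in>{c \<in> carrier G. c \<in> nonsquares G}. 2 / real (ord c))"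
    using card_maximal_cyclic_subgroups[OF nontriv fin] by simp
  also have "\<dots> = (\<Sum>c\<in>carrier G. if c \<in> nonsquares G then 2 / real (ord c) else 0)"
    using fin by (rule sum.inter_filter)
  also have "\<dots> = (\<Sum>p\<in>{..<2 ^ k} \<times> {..<2 ^ l}. ?N (fst p) (snd p))"
    unfolding sum.reindex_bij_betw[OF bij_betw_pt, symmetric]
    by (rule sum.cong[OF HOL.refl]) (auto simp: pt_nonsquare_iff[simplified])
  also have "\<dots> = (\<Sum>i<2 ^ k. \<Sum>j<2 ^ l. ?N i j)"
    by (simp add: sum.cartesian_product case_prod_beta)
  also have "\<dots> = (\<Sum>i<?h. 2 ^ l * (1 / real (max (2 ^ l) (?h div gcd i ?h)))) + (\<Sum>i<?h. 2 ^ l * (2 / 2 ^ k))"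
    unfolding k2 sum_lessThan_double even_sum odd_sum by simp
  also have "\<dots> = 2 ^ l * (1 + (real (k - 1) - real l) / 2) + 2 ^ l"
    using l_pos l_le_k sum_inverse_max_order[of l "k - 1"]
    unfolding sum_distrib_left[symmetric] by (simp add: k2')
  also have "\<dots> = real (2 ^ (l - 1) * (k - l + 3))"
    using l_pos l_le_k by (simp add: l2' of_nat_diff field_simps)
  finally show ?thesis
    by (simp only: of_nat_eq_iff)
qed

end

section \<open>Orbits of an involution\<close>

text \<open>
  Orbits are singletons at fixed points and two-element sets elsewhere.
\<close>

lemma card_orbits_involution:
  assumes fin: "finite S" and closed: "\<And>H. H \<in> S \<Longrightarrow> \<sigma> H \<in> S"
    and inv: "\<And>H. H \<in> S \<Longrightarrow> \<sigma> (\<sigma> H) = H"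
  shows "2 * card ((\<lambda>H. {H, \<sigma> H}) ` S) = card S + card {H \<in> S. \<sigma> H = H}"
proof -
  let ?o = "\<lambda>H. {H, \<sigma> H}"
  let ?F = "{H \<in> S. \<sigma> H = H}" and ?N = "{H \<in> S. \<sigma> H \<noteq> H}"
  have disj: "?o ` ?F \<inter> ?o ` ?N = {}"
    by (auto simp: doubleton_eq_iff)
  have "?o ` S = ?o ` ?F \<union> ?o ` ?N"
    by auto
  then have c: "card (?o ` S) = card (?o ` ?F) + card (?o ` ?N)"
    using fin disj by (simp add: card_Un_disjoint)
  have "inj_on ?o ?F"
    by (auto simp: inj_on_def)
  then have F: "card (?o ` ?F) = card ?F"
    by (rule card_image)
  have U: "\<Union> (?o ` ?N) = ?N"
  proof (intro equalityI subsetI)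
    fix K assume "K \<in> \<Union> (?o ` ?N)"
    then obtain H where H: "H \<in> S" "\<sigma> H \<noteq> H" "K = H \<or> K = \<sigma> H"
      by blast
    then show "K \<in> ?N"
      using closed[OF H(1)] inv[OF H(1)] by auto
  qed blast
  have "2 * card (?o ` ?N) = card (\<Union> (?o ` ?N))"
  proof (rule card_partition)
    show "finite (\<Union> (?o ` ?N))"
      unfolding U using fin by simp
  next
    fix A assume "A \<in> ?o ` ?N"
    then obtain H where "\<sigma> H \<noteq> H" "A = {H, \<sigma> H}" by blast
    then show "card A = 2" by auto
  next
    fix A B assume "A \<in> ?o ` ?N" "B \<in> ?o ` ?N" "A \<noteq> B"
    then obtain H K where HK: "H \<in> S" "K \<in> S" "A = {H, \<sigma> H}" "B = {K, \<sigma> K}" "A \<noteq> B"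
      by blast
    have "H \<noteq> K"
      using HK by blast
    moreover have "H \<noteq> \<sigma> K"
      using HK inv[OF HK(2)] by (metis insert_commute)
    moreover have "\<sigma> H \<noteq> K"
      using HK inv[OF HK(1)] by (metis insert_commute)
    moreover have "\<sigma> H \<noteq> \<sigma> K"
      using \<open>H \<noteq> K\<close> inv[OF HK(1)] inv[OF HK(2)] by metis
    ultimately show "A \<inter> B = {}"
      unfolding HK(3,4) by blast
  qed (use fin in simp)
  then have N: "2 * card (?o ` ?N) = card ?N"
    using U by simp
  have "card S = card (?F \<union> ?N)"
    by (rule arg_cong[of _ _ card]) auto
  also have "\<dots> = card ?F + card ?N"
    using fin by (intro card_Un_disjoint) auto
  finally show ?thesis
    using c F N by simp
qed

section \<open>Groups in which an element inverts a normal cyclic subgroup\<close>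

text \<open>
  The parameters are shifted by one against the presentation: \<open>x\<close> has order \<open>2\<^bsup>a+1\<^esup>\<close> and \<open>y\<close> has
  order \<open>2\<^bsup>b+2\<^esup>\<close>.  The condition \<open>relators\<close> describes the lattice of exponents spanned by
  \<open>(2\<^bsup>a+1\<^esup>, 0)\<close> and \<open>(-2\<^sup>a, 2\<^bsup>b+1\<^esup>)\<close> in a form symmetric in the two generators, so that for even
  exponents of \<open>y\<close> the roles of \<open>x, a\<close> and \<open>y\<^sup>2, b\<close> can be exchanged.
\<close>

locale neg_metacyclic = group +
  fixes x y :: 'a and a b :: nat
  assumes x_closed [simp]: "x \<in> carrier G" and y_closed [simp]: "y \<in> carrier G"
    and a_ge: "2 \<le> a" and b_ge: "2 \<le> b"
    and inverts: "inv y \<otimes> x \<otimes> y = inv x"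
    and spanned: "g \<in> carrier G \<Longrightarrow> \<exists>(i::int) (j::int). g = x [^] i \<otimes> y [^] j"
    and relators: "\<And>(i::int) (j::int). x [^] i \<otimes> y [^] j = \<one> \<longleftrightarrow>
      (\<exists>s t. i = 2 ^ a * s \<and> j = 2 ^ (b + 1) * t \<and> even (s + t))"
begin

definition el :: "int \<Rightarrow> int \<Rightarrow> 'a" where
  "el i j = x [^] i \<otimes> y [^] j"

lemma el_closed [simp]: "el i j \<in> carrier G"
  by (simp add: el_def)

lemma y_pow_x_pow:
  "y [^] (j::int) \<otimes> x [^] (i::int) = x [^] (if even j then i else - i) \<otimes> y [^] j"
proof -
  note y_x_pow = inverting_element_int_pow(1)[OF inverts x_closed y_closed]
  have sq: "y \<otimes> y = y [^] (2::int)"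
    using int_pow_mult[OF y_closed, of 1 1] by simp
  have "y \<otimes> y \<otimes> x = x \<otimes> (y \<otimes> y)"
    using y_x_pow[of 1] y_x_pow[of "-1"] by (simp add: m_assoc) (simp flip: m_assoc)
  then have "x \<otimes> y [^] (2::int) = y [^] (2::int) \<otimes> x"
    by (simp only: sq)
  then have "y [^] (2 * h) \<otimes> x [^] i = x [^] i \<otimes> y [^] (2 * h)" for i h :: int
    using int_pow_commute[of x "y [^] (2::int)" i h] by (simp add: int_pow_pow)
  note ev = this
  show ?thesis
  proof (cases "even j")
    case True
    then show ?thesis using ev by (auto elim!: evenE)
  next
    case False
    then obtain h where h: "j = 2 * h + 1" by (rule oddE)
    have "y [^] j \<otimes> x [^] i = y [^] (2 * h) \<otimes> (y \<otimes> x [^] i)"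
      by (simp add: h int_pow_mult m_assoc)
    also have "\<dots> = (y [^] (2 * h) \<otimes> x [^] (- i)) \<otimes> y"
      by (simp add: y_x_pow m_assoc)
    also have "\<dots> = x [^] (- i) \<otimes> y [^] j"
      by (simp add: ev h int_pow_mult m_assoc)
    finally show ?thesis using False by simp
  qed
qed

lemma el_mult: "el i j \<otimes> el k l = el (if even j then i + k else i - k) (j + l)"
proof -
  have "el i j \<otimes> el k l = x [^] i \<otimes> (y [^] j \<otimes> x [^] k) \<otimes> y [^] l"
    by (simp add: el_def m_assoc)
  also have "\<dots> = (x [^] i \<otimes> x [^] (if even j then k else - k)) \<otimes> (y [^] j \<otimes> y [^] l)"
    by (simp add: y_pow_x_pow m_assoc)
  also have "\<dots> = el (i + (if even j then k else - k)) (j + l)"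
    by (simp only: el_def int_pow_mult x_closed y_closed)
  finally show ?thesis by simp
qed

lemma el_0_0 [simp]: "el 0 0 = \<one>"
  by (simp add: el_def)

lemma el_eq_iff:
  "el i j = el k l \<longleftrightarrow> (\<exists>s t. i - k = 2 ^ a * s \<and> j - l = 2 ^ (b + 1) * t \<and> even (s + t))"
proof -
  have "el i j = el k l \<longleftrightarrow> el (- k) 0 \<otimes> el i j \<otimes> el 0 (- l) = el (- k) 0 \<otimes> el k l \<otimes> el 0 (- l)"
    by simp
  also have "\<dots> \<longleftrightarrow> el (i - k) (j - l) = \<one>"
    by (simp only: el_mult) simp
  also have "\<dots> \<longleftrightarrow> (\<exists>s t. i - k = 2 ^ a * s \<and> j - l = 2 ^ (b + 1) * t \<and> even (s + t))"
    unfolding el_def by (rule relators)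
  finally show ?thesis .
qed

lemma el_eq_parity:
  assumes "el i j = el k l"
  shows "even i \<longleftrightarrow> even k" "even j \<longleftrightarrow> even l"
proof -
  obtain s t where "i - k = 2 ^ a * s" "j - l = 2 ^ (b + 1) * t"
    using assms el_eq_iff by blast
  then have "even (i - k)" "even (j - l)"
    using a_ge by simp_all
  then show "even i \<longleftrightarrow> even k" "even j \<longleftrightarrow> even l"
    by auto
qed

lemma el_even_pow: "el i (2 * j) [^] (n::int) = el (i * n) (2 * (j * n))"
proof -
  have "x [^] i \<otimes> y [^] (2 * j) = y [^] (2 * j) \<otimes> x [^] i"
    by (simp add: y_pow_x_pow)
  then have "(x [^] i \<otimes> y [^] (2 * j)) [^] n = (x [^] i) [^] n \<otimes> (y [^] (2 * j)) [^] n"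
    by (rule int_pow_mult_distrib) simp_all
  then show ?thesis
    unfolding el_def by (simp add: int_pow_pow mult.assoc)
qed

text \<open>
  For odd \<open>j\<close> the square of \<open>x\<^sup>i y\<^sup>j\<close> is \<open>y\<^bsup>2j\<^esup>\<close>, as the two powers of \<open>x\<close> cancel.
\<close>

lemma el_odd_pow_odd:
  assumes "odd j"
  shows "el i j [^] (2 * h + 1 :: int) = el i (j * (2 * h + 1))"
proof -
  have "el i j [^] (2::int) = el i j \<otimes> el i j"
    using int_pow_mult[OF el_closed, of i j 1 1] by simp
  also have "\<dots> = el 0 (2 * j)"
    using assms by (simp add: el_mult)
  finally have "el i j [^] (2 * h) = el 0 (2 * j) [^] h"
    by (metis el_closed int_pow_pow)
  also have "\<dots> = el 0 (2 * (j * h))"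
    by (simp add: el_even_pow)
  finally have "el i j [^] (2 * h + 1) = el 0 (2 * (j * h)) \<otimes> el i j"
    by (simp add: int_pow_mult)
  also have "\<dots> = el i (j * (2 * h + 1))"
    by (simp add: el_mult algebra_simps)
  finally show ?thesis .
qed

definition M :: "'a set" where
  "M = generate G {x, y [^] (2::nat)}"

lemma el_even_mult: "el i (2 * j) \<otimes> el k (2 * l) = el (i + k) (2 * (j + l))"
  by (simp add: el_mult)

lemma M_eq: "M = {el i (2 * j) | i j. True}"
proof
  let ?A = "{el i (2 * j) | i j. True}"
  have ysq: "y [^] (2::nat) = el 0 (2 * 1)"
    using int_pow_int[of G y 2] by (simp add: el_def)
  have xel: "x = el 1 (2 * 0)"
    by (simp add: el_def)
  have A: "subgroup ?A G"
  proof
    fix g h assume "g \<in> ?A" "h \<in> ?A"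
    then obtain i j k l where "g = el i (2 * j)" "h = el k (2 * l)"
      by blast
    then have "g \<otimes> h = el (i + k) (2 * (j + l))"
      by (simp only: el_even_mult)
    then show "g \<otimes> h \<in> ?A"
      by blast
  next
    fix g assume "g \<in> ?A"
    then obtain i j where g: "g = el i (2 * j)" by blast
    have "inv g = g [^] (-1 :: int)"
      by (simp add: g int_pow_neg)
    also have "\<dots> = el (i * - 1) (2 * (j * - 1))"
      unfolding g by (rule el_even_pow)
    finally show "inv g \<in> ?A" by blast
  next
    have "\<one> = el 0 (2 * 0)" by simp
    then show "\<one> \<in> ?A" by blast
  qed auto
  then show "M \<subseteq> ?A"
    unfolding M_def
    by (rule generate_subgroup_incl[rotated]) (use ysq xel in blast)
  have M: "subgroup M G"
    unfolding M_def by (rule generate_is_subgroup) simp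
  show "?A \<subseteq> M"
  proof clarify
    fix i j :: int
    have "x \<in> M" "y [^] (2::nat) \<in> M"
      unfolding M_def by (auto intro: generate.incl)
    then have "x [^] i \<otimes> (y [^] (2::nat)) [^] j \<in> M"
      using subgroup.m_closed[OF M] subgroup_int_pow_closed[OF M] by simp
    moreover have "(y [^] (2::nat)) [^] j = y [^] (2 * j)"
      using int_pow_int[of G y 2] int_pow_pow[OF y_closed, of 2 j] by simp
    ultimately show "el i (2 * j) \<in> M"
      by (simp add: el_def)
  qed
qed

lemma M_subgroup: "subgroup M G"
  unfolding M_def by (rule generate_is_subgroup) simp

lemma el_mem_M_iff: "el i j \<in> M \<longleftrightarrow> even j"
proof
  assume "el i j \<in> M"
  then obtain k l where "el i j = el k (2 * l)"
    unfolding M_eq by blast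
  then show "even j"
    using el_eq_parity(2)[of i j k "2 * l"] by simp
qed (auto simp: M_eq elim!: evenE)

lemma el_even_eq_iff:
  "el i (2 * j) = el k (2 * l) \<longleftrightarrow> (\<exists>s t. i - k = 2 ^ a * s \<and> j - l = 2 ^ b * t \<and> even (s + t))"
proof -
  have "2 * j - 2 * l = 2 ^ (b + 1) * t \<longleftrightarrow> j - l = 2 ^ b * t" for t
    by (simp add: right_diff_distrib[symmetric] mult.assoc del: right_diff_distrib_numeral)
  then show ?thesis
    unfolding el_eq_iff by simp
qed

lemma comm_group_M: "comm_group (G\<lparr>carrier := M\<rparr>)"
proof -
  interpret M: group "G\<lparr>carrier := M\<rparr>"
    by (rule subgroup_imp_group[OF M_subgroup])
  have "g \<otimes> h = h \<otimes> g" if "g \<in> M" "h \<in> M" for g h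
    using that unfolding M_eq by (auto simp only: el_even_mult add.commute)
  then show ?thesis
    by (intro M.group_comm_groupI) simp
qed

text \<open>
  Written additively, \<open>M\<close> is the group of pairs \<open>(i, j)\<close> modulo the lattice of all \<open>(2\<^sup>a s, 2\<^sup>b t)\<close>
  with \<open>s + t\<close> even.  A basis for it only has to be verified in these coordinates.
\<close>

lemma rank_two_M:
  assumes u: "u = el p (2 * q)" and v: "v = el p' (2 * q')"
    and kl: "1 \<le> l" "l \<le> k"
    and spanned: "\<And>i j. \<exists>m n. i = p * m + p' * n \<and> j = q * m + q' * n"
    and independent: "\<And>m n. (\<exists>s t. p * m + p' * n = 2 ^ a * s \<and> q * m + q' * n = 2 ^ b * t \<and> even (s + t))
      \<longleftrightarrow> 2 ^ k dvd m \<and> 2 ^ l dvd n"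
  shows "rank_two_group (G\<lparr>carrier := M\<rparr>) u v k l"
proof -
  interpret M: comm_group "G\<lparr>carrier := M\<rparr>"
    by (rule comm_group_M)
  have uM: "u \<in> M" and vM: "v \<in> M"
    by (simp_all add: u v el_mem_M_iff)
  have pow: "u [^]\<^bsub>G\<lparr>carrier := M\<rparr>\<^esub> m \<otimes>\<^bsub>G\<lparr>carrier := M\<rparr>\<^esub> v [^]\<^bsub>G\<lparr>carrier := M\<rparr>\<^esub> n
      = el (p * m + p' * n) (2 * (q * m + q' * n))" for m n :: int
  proof -
    have "u [^] m \<otimes> v [^] n = el (p * m + p' * n) (2 * (q * m + q' * n))"
      unfolding u v by (simp only: el_even_pow el_even_mult)
    then show ?thesis
      using int_pow_consistent[OF M_subgroup uM] int_pow_consistent[OF M_subgroup vM] by simp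
  qed
  show ?thesis
  proof
    fix g assume "g \<in> carrier (G\<lparr>carrier := M\<rparr>)"
    then obtain i j where g: "g = el i (2 * j)"
      by (auto simp: M_eq)
    obtain m n where "i = p * m + p' * n" "j = q * m + q' * n"
      using spanned by blast
    then show "\<exists>(i::int) (j::int). g = u [^]\<^bsub>G\<lparr>carrier := M\<rparr>\<^esub> i
        \<otimes>\<^bsub>G\<lparr>carrier := M\<rparr>\<^esub> v [^]\<^bsub>G\<lparr>carrier := M\<rparr>\<^esub> j"
      unfolding pow g by blast
  next
    fix m n :: int
    show "u [^]\<^bsub>G\<lparr>carrier := M\<rparr>\<^esub> m \<otimes>\<^bsub>G\<lparr>carrier := M\<rparr>\<^esub> v [^]\<^bsub>G\<lparr>carrier := M\<rparr>\<^esub> n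
        = \<one>\<^bsub>G\<lparr>carrier := M\<rparr>\<^esub> \<longleftrightarrow> 2 ^ k dvd m \<and> 2 ^ l dvd n"
      unfolding pow independent[symmetric]
      using el_even_eq_iff[of "p * m + p' * n" "q * m + q' * n" 0 0] by simp
  qed (use uM vM kl in auto)
qed

text \<open>
  The element \<open>x\<close> has order \<open>2\<^bsup>a+1\<^esup>\<close>, and the correction by \<open>x\<^bsup>-p\<^esup>\<close> with \<open>p = 2\<^bsup>a-b\<^esup>\<close> makes
  \<open>v = y\<^sup>2 x\<^bsup>-p\<^esup>\<close> an element of order \<open>2\<^sup>b\<close>, because \<open>(y\<^sup>2)\<^sup>q = x\<^bsup>pq\<^esup>\<close> for \<open>q = 2\<^sup>b\<close>.
\<close>

lemma rank_two_M_if_le: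
  assumes "b \<le> a"
  shows "rank_two_group (G\<lparr>carrier := M\<rparr>) (el 1 (2 * 0)) (el (- (2 ^ (a - b))) (2 * 1)) (a + 1) b"
proof (rule rank_two_M[OF HOL.refl HOL.refl])
  fix i j :: int
  show "\<exists>m n. i = 1 * m + - (2 ^ (a - b)) * n \<and> j = 0 * m + 1 * n"
    by (rule exI[of _ "i + 2 ^ (a - b) * j"], rule exI[of _ j]) simp
next
  fix m n :: int
  have pw: "(2::int) ^ a = 2 ^ (a - b) * 2 ^ b"
    using assms by (simp flip: power_add)
  show "(\<exists>s t. 1 * m + - (2 ^ (a - b)) * n = 2 ^ a * s \<and> 0 * m + 1 * n = 2 ^ b * t \<and> even (s + t))
      \<longleftrightarrow> 2 ^ (a + 1) dvd m \<and> 2 ^ b dvd n" (is "?L \<longleftrightarrow> ?R")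
  proof
    assume ?L
    then obtain s t where st: "m - 2 ^ (a - b) * n = 2 ^ a * s" "n = 2 ^ b * t" "even (s + t)"
      by auto
    then have "m = 2 ^ a * (s + t)"
      by (simp add: pw algebra_simps)
    then show ?R
      using st by (auto elim!: evenE)
  next
    assume ?R
    then obtain r t where "m = 2 ^ (a + 1) * r" "n = 2 ^ b * t"
      by (auto elim!: dvdE)
    then show ?L
      by (intro exI[of _ "2 * r - t"] exI[of _ t]) (simp add: pw algebra_simps)
  qed
qed (use assms b_ge in auto)

text \<open>
  The mirror image of the previous case: now \<open>y\<^sup>2\<close> has the larger order \<open>2\<^bsup>b+1\<^esup>\<close>, and \<open>x\<close> is corrected
  by a power of \<open>y\<^sup>2\<close>.
\<close>

lemma rank_two_M_if_ge:
  assumes "a \<le> b"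
  shows "rank_two_group (G\<lparr>carrier := M\<rparr>) (el 0 (2 * 1)) (el 1 (2 * (- (2 ^ (b - a))))) (b + 1) a"
proof (rule rank_two_M[OF HOL.refl HOL.refl])
  fix i j :: int
  show "\<exists>m n. i = 0 * m + 1 * n \<and> j = 1 * m + - (2 ^ (b - a)) * n"
    by (rule exI[of _ "j + 2 ^ (b - a) * i"], rule exI[of _ i]) simp
next
  fix m n :: int
  have pw: "(2::int) ^ b = 2 ^ (b - a) * 2 ^ a"
    using assms by (simp flip: power_add)
  show "(\<exists>s t. 0 * m + 1 * n = 2 ^ a * s \<and> 1 * m + - (2 ^ (b - a)) * n = 2 ^ b * t \<and> even (s + t))
      \<longleftrightarrow> 2 ^ (b + 1) dvd m \<and> 2 ^ a dvd n" (is "?L \<longleftrightarrow> ?R")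
  proof
    assume ?L
    then obtain s t where st: "m - 2 ^ (b - a) * n = 2 ^ b * t" "n = 2 ^ a * s" "even (s + t)"
      by auto
    then have "m = 2 ^ b * (s + t)"
      by (simp add: pw algebra_simps)
    then show ?R
      using st by (auto elim!: evenE)
  next
    assume ?R
    then obtain r s where "m = 2 ^ (b + 1) * r" "n = 2 ^ a * s"
      by (auto elim!: dvdE)
    then show ?L
      by (intro exI[of _ s] exI[of _ "2 * r - s"]) (simp add: pw algebra_simps)
  qed
qed (use assms a_ge in auto)

lemma two_group_M: "two_group (G\<lparr>carrier := M\<rparr>)" and finite_M: "finite M"
proof -
  obtain u v k l where "rank_two_group (G\<lparr>carrier := M\<rparr>) u v k l"
    using rank_two_M_if_le rank_two_M_if_ge nle_le by metis
  then interpret M: rank_two_group "G\<lparr>carrier := M\<rparr>" u v k l .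
  show "two_group (G\<lparr>carrier := M\<rparr>)"
    by (rule M.two_group_axioms)
  show "finite M"
    using bij_betw_finite[OF M.bij_betw_pt] by simp
qed

lemma eta_M_eq_card: "eta (G\<lparr>carrier := M\<rparr>) = card (maximal_cyclic_subgroups (G\<lparr>carrier := M\<rparr>))"
  using comm_group.eta_eq_card_maximal_cyclic_subgroups[OF comm_group_M] .

lemma eta_M:
  "b \<le> a \<Longrightarrow> eta (G\<lparr>carrier := M\<rparr>) = g2 (a + 1) b"
  "a \<le> b \<Longrightarrow> eta (G\<lparr>carrier := M\<rparr>) = g2 a (b + 1)"
proof -
  assume le: "b \<le> a"
  interpret M: rank_two_group "G\<lparr>carrier := M\<rparr>" "el 1 (2 * 0)" "el (- (2 ^ (a - b))) (2 * 1)" "a + 1" b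
    by (rule rank_two_M_if_le[OF le])
  show "eta (G\<lparr>carrier := M\<rparr>) = g2 (a + 1) b"
    using le by (simp add: eta_M_eq_card M.card_maximal_cyclic_subgroups_rank_two g2_def)
next
  assume le: "a \<le> b"
  interpret M: rank_two_group "G\<lparr>carrier := M\<rparr>" "el 0 (2 * 1)" "el 1 (2 * (- (2 ^ (b - a))))" "b + 1" a
    by (rule rank_two_M_if_ge[OF le])
  show "eta (G\<lparr>carrier := M\<rparr>) = g2 a (b + 1)"
    using le by (simp add: eta_M_eq_card M.card_maximal_cyclic_subgroups_rank_two g2_def)
qed

lemma el_odd_square: "odd j \<Longrightarrow> el i j \<otimes> el i j = el 0 (2 * j)"
  by (simp add: el_mult)

lemma square_mem_M:
  assumes "g \<in> carrier G"
  shows "g \<otimes> g \<in> M"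
proof -
  obtain i j where "g = el i j"
    using spanned assms unfolding el_def by blast
  then show ?thesis
    by (simp add: el_mult el_mem_M_iff)
qed

sublocale two_group
proof
  fix c assume c: "c \<in> carrier G"
  interpret M: two_group "G\<lparr>carrier := M\<rparr>"
    by (rule two_group_M)
  have "c \<otimes> c \<in> carrier (G\<lparr>carrier := M\<rparr>)"
    using square_mem_M[OF c] by simp
  then obtain m where "(c \<otimes> c) [^]\<^bsub>G\<lparr>carrier := M\<rparr>\<^esub> (2 ^ m :: nat) = \<one>\<^bsub>G\<lparr>carrier := M\<rparr>\<^esub>"
    using M.torsion by blast
  then have "(c \<otimes> c) [^] (2 ^ m :: nat) = \<one>"
    unfolding nat_pow_consistent[symmetric] by simp
  moreover have "c \<otimes> c = c [^] (2::nat)"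
    using c by (simp add: numeral_2_eq_2)
  ultimately have "c [^] (2 * 2 ^ m :: nat) = \<one>"
    using nat_pow_pow[OF c, of 2 "2 ^ m"] by simp
  then have "c [^] (2 ^ Suc m :: nat) = \<one>"
    by (simp only: power_Suc)
  then show "\<exists>m. c [^] (2 ^ m :: nat) = \<one>" ..
qed

lemma maximal_cyclic_subgroups_M:
  "maximal_cyclic_subgroups (G\<lparr>carrier := M\<rparr>) =
    {generate G {el i (2 * j)} | i j. odd i \<or> odd j}"
proof -
  interpret M: two_group "G\<lparr>carrier := M\<rparr>"
    by (rule two_group_M)
  have "el 1 (2 * 0) \<noteq> el 0 0"
    using el_eq_parity(1)[of 1 "2 * 0" 0 0] by auto
  then have "\<exists>e\<in>carrier (G\<lparr>carrier := M\<rparr>). e \<noteq> \<one>\<^bsub>G\<lparr>carrier := M\<rparr>\<^esub>"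
    by (intro bexI[of _ "el 1 (2 * 0)"]) (simp_all add: el_mem_M_iff)
  note eq = M.maximal_cyclic_subgroups_eq[OF this]
  have sq: "(\<exists>d\<in>M. el i (2 * j) = d \<otimes> d) \<longleftrightarrow> even i \<and> even j" for i j
  proof
    assume "\<exists>d\<in>M. el i (2 * j) = d \<otimes> d"
    then obtain k l where "el i (2 * j) = el k (2 * l) \<otimes> el k (2 * l)"
      unfolding M_eq by blast
    then have "el i (2 * j) = el (k + k) (2 * (l + l))"
      by (simp only: el_even_mult)
    then obtain s t where "i - (k + k) = 2 ^ a * s" "j - (l + l) = 2 ^ b * t"
      unfolding el_even_eq_iff by blast
    then have "even (i - (k + k))" "even (j - (l + l))"
      using a_ge b_ge by simp_all
    then show "even i \<and> even j" by simp
  next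
    assume "even i \<and> even j"
    then obtain k l where "i = k + k" "j = l + l"
      by (metis evenE mult_2)
    then have "el i (2 * j) = el k (2 * l) \<otimes> el k (2 * l)"
      by (simp only: el_even_mult)
    then show "\<exists>d\<in>M. el i (2 * j) = d \<otimes> d"
      using el_mem_M_iff by auto
  qed
  have "nonsquares (G\<lparr>carrier := M\<rparr>) = {el i (2 * j) | i j. odd i \<or> odd j}"
  proof (intro equalityI subsetI)
    fix g assume "g \<in> nonsquares (G\<lparr>carrier := M\<rparr>)"
    then have "g \<in> M" and ns: "\<not> (\<exists>d\<in>M. g = d \<otimes> d)"
      by (auto simp: nonsquares_def)
    then obtain i j where g: "g = el i (2 * j)"
      unfolding M_eq by blast
    then have "odd i \<or> odd j"
      using ns sq[of i j] by blast
    then show "g \<in> {el i (2 * j) | i j. odd i \<or> odd j}"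
      using g by blast
  next
    fix g assume "g \<in> {el i (2 * j) | i j. odd i \<or> odd j}"
    then obtain i j where g: "g = el i (2 * j)" "odd i \<or> odd j"
      by blast
    then have "g \<in> M" "\<not> (\<exists>d\<in>M. g = d \<otimes> d)"
      using sq[of i j] by (simp_all add: el_mem_M_iff)
    then show "g \<in> nonsquares (G\<lparr>carrier := M\<rparr>)"
      by (auto simp: nonsquares_def)
  qed
  moreover have "generate (G\<lparr>carrier := M\<rparr>) {el i (2 * j)} = generate G {el i (2 * j)}" for i j
    by (rule generate_consistent[OF _ M_subgroup]) (simp add: el_mem_M_iff)
  moreover have "(\<lambda>c. generate H {c}) ` {el i (2 * j) | i j. odd i \<or> odd j}
      = {generate H {el i (2 * j)} | i j. odd i \<or> odd j}" for H :: "('a, 'b) monoid_scheme"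
    by blast
  ultimately show ?thesis
    unfolding eq by (simp only:)
qed

subsection \<open>Conjugacy classes of maximal cyclic subgroups\<close>

abbreviation cyc :: "int \<Rightarrow> int \<Rightarrow> 'a set" where
  "cyc i j \<equiv> generate G {el i (2 * j)}"

lemma cyc_eq_iff:
  "cyc i j = cyc k l \<longleftrightarrow>
    (\<exists>m s t. odd m \<and> k - i * m = 2 ^ a * s \<and> l - j * m = 2 ^ b * t \<and> even (s + t))"
  unfolding generate_eq_iff[OF el_closed el_closed] el_even_pow el_even_eq_iff by blast

lemma cyc_eqI:
  assumes "odd m" "k - i * m = 2 ^ a * s" "l - j * m = 2 ^ b * t" "even (s + t)"
  shows "cyc i j = cyc k l"
  unfolding cyc_eq_iff using assms by blast

lemma cyc_eq_parity:
  assumes "cyc i j = cyc k l"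
  shows "even i \<longleftrightarrow> even k" "even j \<longleftrightarrow> even l"
proof -
  obtain m s t where m: "odd m" and st: "k - i * m = 2 ^ a * s" "l - j * m = 2 ^ b * t"
    using assms unfolding cyc_eq_iff by blast
  have "even (2 ^ a * s)" "even (2 ^ b * t)"
    using a_ge b_ge by simp_all
  then have "even (k - i * m)" "even (l - j * m)"
    using st by simp_all
  then show "even i \<longleftrightarrow> even k" "even j \<longleftrightarrow> even l"
    using m by auto
qed

lemma cyc_subset_M: "cyc i j \<subseteq> M"
  by (rule generate_subgroup_incl[OF _ M_subgroup]) (simp add: el_mem_M_iff)

text \<open>
  The square of \<open>x\<^sup>i y\<close> is \<open>y\<^sup>2\<close>, so multiplying \<open>x\<^sup>i y\<close> by powers of \<open>y\<^sup>2\<close> gives its odd powers.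
\<close>

lemma generate_el_odd:
  assumes "odd j"
  shows "generate G {el i j} = generate G {el i 1}"
proof -
  obtain h where h: "j = 2 * h + 1"
    using assms by (rule oddE)
  have "el i j = el i 1 [^] (2 * h + 1)"
    using el_odd_pow_odd[of 1 i h] h by simp
  moreover have "odd (2 * h + 1)" by simp
  ultimately show ?thesis
    using generate_eq_iff[OF el_closed el_closed, of i 1 i j] by blast
qed

lemma conj_eqI:
  assumes "g \<in> carrier G" "h \<in> carrier G" "c \<in> carrier G" "c \<otimes> g = g \<otimes> h"
  shows "inv g \<otimes> c \<otimes> g = h"
  using assms by (simp add: m_assoc inv_mult_cancel_left)

lemma conj_el_even:
  "inv (el k l) \<otimes> el i (2 * j) \<otimes> el k l = el (if even l then i else - i) (2 * j)"
  by (rule conj_eqI) (simp_all add: el_mult add.commute)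

lemma conj_el_1:
  "inv (el k l) \<otimes> el i 1 \<otimes> el k l = el (if even l then i - 2 * k else 2 * k - i) 1"
  by (rule conj_eqI) (simp_all add: el_mult add.commute)

lemma obtain_el:
  assumes "g \<in> carrier G"
  obtains i j where "g = el i j"
  using spanned[OF assms] unfolding el_def by blast

text \<open>
  Besides the squares of \<open>M\<close>, an element of \<open>M\<close> can be the square of an element outside \<open>M\<close>; those
  squares are the odd powers of \<open>y\<^sup>2\<close>, that is the generators of \<open>\<langle>y\<^sup>2\<rangle>\<close>.
\<close>

lemma square_iff:
  "(\<exists>d\<in>carrier G. el i (2 * j) = d \<otimes> d) \<longleftrightarrow> even i \<and> even j \<or> cyc i j = cyc 0 1"
proof
  assume "\<exists>d\<in>carrier G. el i (2 * j) = d \<otimes> d"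
  then obtain d where d: "d \<in> carrier G" "el i (2 * j) = d \<otimes> d" by blast
  obtain k l where dkl: "d = el k l" by (rule obtain_el[OF d(1)])
  show "even i \<and> even j \<or> cyc i j = cyc 0 1"
  proof (cases "even l")
    case True
    then obtain h where "l = 2 * h" by (rule evenE)
    then have "el i (2 * j) = el (k + k) (2 * (h + h))"
      using d(2) dkl by (simp only: el_even_mult)
    then have "cyc i j = cyc (k + k) (h + h)"
      by simp
    then show ?thesis
      using cyc_eq_parity[of i j "k + k" "h + h"] by simp
  next
    case False
    then have "el i (2 * j) = el (0 * l) (2 * (1 * l))"
      using d(2) dkl by (simp add: el_odd_square)
    then have "el i (2 * j) = el 0 (2 * 1) [^] l"
      by (simp only: el_even_pow)
    then show ?thesis
      using False generate_eq_iff[OF el_closed el_closed, of 0 "2 * 1" i "2 * j"] by blast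
  qed
next
  assume "even i \<and> even j \<or> cyc i j = cyc 0 1"
  then show "\<exists>d\<in>carrier G. el i (2 * j) = d \<otimes> d"
  proof
    assume "even i \<and> even j"
    then obtain k l where "i = k + k" "j = l + l"
      by (metis evenE mult_2)
    then have "el i (2 * j) = el k (2 * l) \<otimes> el k (2 * l)"
      by (simp only: el_even_mult)
    then show ?thesis
      using el_closed by blast
  next
    assume "cyc i j = cyc 0 1"
    then obtain l :: int where l: "odd l" "el i (2 * j) = el 0 (2 * 1) [^] l"
      using generate_eq_iff[OF el_closed el_closed, of 0 "2 * 1" i "2 * j"] by metis
    then have "el i (2 * j) = el 0 (2 * l)"
      by (simp only: el_even_pow mult_zero_left mult_1)
    then have "el i (2 * j) = el 0 l \<otimes> el 0 l"
      by (simp only: el_odd_square[OF l(1)])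
    then show ?thesis
      using el_closed by blast
  qed
qed

definition outer_cyclic :: "'a set set" where
  "outer_cyclic = range (\<lambda>i. generate G {el i 1})"

definition inner_cyclic :: "'a set set" where
  "inner_cyclic = maximal_cyclic_subgroups (G\<lparr>carrier := M\<rparr>) - {cyc 0 1}"

lemma inner_cyclic_eq:
  "inner_cyclic = {cyc i j | i j. (odd i \<or> odd j) \<and> cyc i j \<noteq> cyc 0 1}"
  unfolding inner_cyclic_def maximal_cyclic_subgroups_M by blast

text \<open>
  The subgroup \<open>\<langle>y\<^sup>2\<rangle>\<close> is maximal cyclic in \<open>M\<close> but lies in every \<open>\<langle>x\<^sup>i y\<rangle>\<close>.  It is the only one lost
  from \<open>M\<close> to \<open>G\<close>.
\<close>

lemma maximal_cyclic_subgroups_G: "maximal_cyclic_subgroups G = outer_cyclic \<union> inner_cyclic"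
proof -
  have "el 1 (2 * 0) \<noteq> el 0 0"
    using el_eq_parity(1)[of 1 "2 * 0" 0 0] by auto
  then have "el 1 (2 * 0) \<noteq> \<one>"
    by simp
  then have "\<exists>e\<in>carrier G. e \<noteq> \<one>"
    using el_closed by blast
  note eq = maximal_cyclic_subgroups_eq[OF this]
  show ?thesis
  proof (intro equalityI subsetI)
    fix H assume "H \<in> maximal_cyclic_subgroups G"
    then obtain c where c: "c \<in> carrier G" "\<not> (\<exists>d\<in>carrier G. c = d \<otimes> d)" "H = generate G {c}"
      unfolding eq by (auto simp: nonsquares_def)
    obtain i j where ij: "c = el i j" by (rule obtain_el[OF c(1)])
    show "H \<in> outer_cyclic \<union> inner_cyclic"
    proof (cases "even j")
      case True
      then obtain h where "j = 2 * h" by (rule evenE)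
      then have "H = cyc i h" "\<not> (even i \<and> even h \<or> cyc i h = cyc 0 1)"
        using c ij square_iff[of i h] by simp_all
      then show ?thesis
        unfolding inner_cyclic_eq by blast
    next
      case False
      then show ?thesis
        unfolding outer_cyclic_def using c(3) ij generate_el_odd by blast
    qed
  next
    fix H assume "H \<in> outer_cyclic \<union> inner_cyclic"
    then obtain c where c: "c \<in> carrier G" "\<not> (\<exists>d\<in>carrier G. c = d \<otimes> d)" "H = generate G {c}"
    proof
      assume "H \<in> outer_cyclic"
      then obtain i where i: "H = generate G {el i 1}"
        unfolding outer_cyclic_def by blast
      have "el i 1 \<notin> M"
        by (simp add: el_mem_M_iff)
      then have "\<not> (\<exists>d\<in>carrier G. el i 1 = d \<otimes> d)"
        using square_mem_M by metis
      then show thesis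
        using that[of "el i 1"] i by simp
    next
      assume "H \<in> inner_cyclic"
      then obtain i j where "H = cyc i j" "odd i \<or> odd j" "cyc i j \<noteq> cyc 0 1"
        unfolding inner_cyclic_eq by blast
      then show thesis
        using that[of "el i (2 * j)"] square_iff[of i j] by auto
    qed
    then show "H \<in> maximal_cyclic_subgroups G"
      unfolding eq by (auto simp: nonsquares_def)
  qed
qed

text \<open>
  Conjugation by \<open>x\<^sup>k\<close> turns \<open>x\<^sup>i y\<close> into \<open>x\<^bsup>i-2k\<^esup> y\<close>, so only the parity of \<open>i\<close> matters.  Conversely
  the parity of the exponent of \<open>x\<close> is well defined and unchanged by conjugation and by odd powers, which
  separates \<open>\<langle>y\<rangle>\<close> from \<open>\<langle>x y\<rangle>\<close>.
\<close>

lemma conj_class_outer: "card (conj_class G ` outer_cyclic) = 2"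
proof -
  let ?c = "\<lambda>i. conj_class G (generate G {el i 1})"
  have gsub: "generate G {el i 1} \<subseteq> carrier G" for i
    by (rule generate_incl) simp
  have "?c i = ?c (i mod 2)" for i
  proof -
    have "conj_subset G (generate G {el (i mod 2) 1}) (el (- (i div 2)) 0) = generate G {el i 1}"
      by (simp add: conj_subset_generate conj_el_1)
    then show ?thesis
      using conj_class_conj_subset[OF el_closed gsub] by metis
  qed
  moreover have "i mod 2 = 0 \<or> i mod 2 = 1" for i :: int
    by presburger
  ultimately have "?c i \<in> {?c 0, ?c 1}" for i
    by (metis insertCI)
  then have "range ?c = {?c 0, ?c 1}"
    by blast
  then have "conj_class G ` outer_cyclic = {?c 0, ?c 1}"
    unfolding outer_cyclic_def image_image .
  moreover have "?c 0 \<noteq> ?c 1"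
  proof
    assume "?c 0 = ?c 1"
    then have "generate G {el 1 1} \<in> ?c 0"
      using self_in_conj_class[OF gsub] by simp
    then obtain g where g: "g \<in> carrier G" "generate G {el 1 1} = conj_subset G (generate G {el 0 1}) g"
      unfolding conj_class_def by blast
    obtain k l where kl: "g = el k l" by (rule obtain_el[OF g(1)])
    define i where "i = (if even l then 0 - 2 * k else 2 * k - 0)"
    have i: "even i"
      by (simp add: i_def)
    have "generate G {el i 1} = generate G {el 1 1}"
      unfolding g(2) kl conj_subset_generate[OF el_closed el_closed] conj_el_1 i_def ..
    then obtain m :: int where m: "odd m" "el 1 1 = el i 1 [^] m"
      using generate_eq_iff[OF el_closed el_closed, of i 1 1 1] by blast
    then obtain h where "m = 2 * h + 1" by (blast elim: oddE)
    then have "el 1 1 = el i m"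
      using m(2) el_odd_pow_odd[of 1 i h] by simp
    then show False
      using el_eq_parity(1)[of 1 1 i m] i by simp
  qed
  ultimately show ?thesis by simp
qed

definition conj_y :: "'a set \<Rightarrow> 'a set" where
  "conj_y H = conj_subset G H (el 0 1)"

lemma conj_y_cyc: "conj_y (cyc i j) = cyc (- i) j"
  by (simp add: conj_y_def conj_subset_generate conj_el_even)

lemma conj_class_cyc: "conj_class G (cyc i j) = {cyc i j, cyc (- i) j}"
proof -
  have *: "conj_subset G (cyc i j) (el k l) = cyc (if even l then i else - i) j" for k l
    by (simp only: conj_subset_generate[OF el_closed el_closed] conj_el_even)
  show ?thesis
  proof (intro equalityI subsetI)
    fix H assume "H \<in> conj_class G (cyc i j)"
    then obtain g where g: "g \<in> carrier G" "H = conj_subset G (cyc i j) g"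
      unfolding conj_class_def by blast
    obtain k l where "g = el k l" by (rule obtain_el[OF g(1)])
    then show "H \<in> {cyc i j, cyc (- i) j}"
      using g(2) * by simp
  next
    fix H assume "H \<in> {cyc i j, cyc (- i) j}"
    then have "H = conj_subset G (cyc i j) (el 0 0) \<or> H = conj_subset G (cyc i j) (el 0 1)"
      unfolding * by auto
    then show "H \<in> conj_class G (cyc i j)"
      unfolding conj_class_def using el_closed by blast
  qed
qed

lemma pow2_split: "(2::int) ^ a = 2 * 2 ^ (a - 1)" "(2::int) ^ b = 2 * 2 ^ (b - 1)"
  "even ((2::int) ^ (a - 1))" "even ((2::int) ^ (b - 1))"
  using a_ge b_ge by (simp_all flip: power_Suc)

text \<open>
  Invariance means that \<open>x\<^bsup>-i\<^esup> y\<^bsup>2j\<^esup>\<close> is the \<open>m\<close>-th power of \<open>x\<^sup>i y\<^bsup>2j\<^esup>\<close>, for an odd \<open>m\<close>.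
  Comparing the exponents of \<open>y\<close> gives \<open>m = 1 + 2\<^sup>b q\<close>, so \<open>m + 1\<close> is twice an odd number, and
  comparing those of \<open>x\<close> shows that \<open>i\<close> is a multiple \<open>p 2\<^bsup>a-1\<^esup>\<close>.  The parity of \<open>p\<close> decides between the
  two subgroups.
\<close>

lemma fixed_if_odd_right:
  assumes "odd j" "cyc (- i) j = cyc i j"
  shows "cyc i j = cyc 0 1 \<or> cyc i j = cyc (2 ^ (a - 1)) 1"
proof -
  obtain m s t where m: "odd m" "i - - i * m = 2 ^ a * s" "j - j * m = 2 ^ b * t"
    using assms(2) unfolding cyc_eq_iff by blast
  have "coprime (2 ^ b) j"
    using assms(1) by simp
  moreover have "2 ^ b dvd j * (m - 1)"
    using m(3) by (metis dvd_triv_left dvd_minus_iff minus_diff_eq mult.right_neutral right_diff_distrib)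
  ultimately have "2 ^ b dvd m - 1"
    using coprime_dvd_mult_right_iff by blast
  then obtain q where q: "m = 1 + 2 ^ b * q"
    by (auto elim!: dvdE simp: algebra_simps)
  have "2 * (i * (1 + 2 ^ (b - 1) * q)) = 2 * (2 ^ (a - 1) * s)"
    using m(2) unfolding q pow2_split(1,2) by (simp add: algebra_simps)
  then have "2 ^ (a - 1) dvd i * (1 + 2 ^ (b - 1) * q)"
    by simp
  moreover have "coprime (2 ^ (a - 1)) (1 + 2 ^ (b - 1) * q)"
    using pow2_split(4) by simp
  ultimately have "2 ^ (a - 1) dvd i"
    using coprime_dvd_mult_left_iff by blast
  then obtain p where p: "i = 2 ^ (a - 1) * p" ..
  show ?thesis
  proof (cases "even p")
    case True
    then obtain r where r: "p = 2 * r" by (rule evenE)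
    have "cyc 0 1 = cyc i j"
      by (rule cyc_eqI[of "j + 2 ^ b * r" _ _ r _ _ "- r"])
         (use assms(1) b_ge in \<open>simp_all add: p r pow2_split(1)\<close>)
    then show ?thesis by simp
  next
    case False
    then have "even (p - j)"
      using assms(1) by simp
    then obtain r where r: "p = j + 2 * r"
      by (metis diff_eq_eq add.commute evenE)
    \<comment> \<open>The exponent \<open>j + 2\<^sup>b r\<close> differs from the obvious \<open>j\<close> by a multiple of \<open>2\<^sup>b\<close>, which makes the parities of \<open>s\<close> and \<open>t\<close> agree.\<close>
    have "cyc (2 ^ (a - 1)) 1 = cyc i j"
      by (rule cyc_eqI[of "j + 2 ^ b * r" _ _ "r - 2 ^ (b - 1) * r" _ _ "- r"])
         (use assms(1) b_ge pow2_split(4) in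
           \<open>simp_all add: p r pow2_split(1) algebra_simps\<close>, simp_all add: pow2_split(2))
    then show ?thesis by simp
  qed
qed

text \<open>
  The mirror image of the previous lemma, with the sign of \<open>m\<close> reversed: now \<open>m + 1\<close> is a multiple of
  \<open>2\<^sup>a\<close> and \<open>m - 1\<close> is twice an odd number.
\<close>

lemma fixed_if_odd_left:
  assumes "odd i" "cyc (- i) j = cyc i j"
  shows "cyc i j = cyc 1 0 \<or> cyc i j = cyc 1 (2 ^ (b - 1))"
proof -
  obtain m s t where m: "odd m" "i - - i * m = 2 ^ a * s" "j - j * m = 2 ^ b * t"
    using assms(2) unfolding cyc_eq_iff by blast
  have "coprime (2 ^ a) i"
    using assms(1) by simp
  moreover have "2 ^ a dvd i * (m + 1)"
    using m(2) by (metis dvd_triv_left add.commute minus_mult_minus diff_minus_eq_add mult_minus_left mult.right_neutral distrib_left)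
  ultimately have "2 ^ a dvd m + 1"
    using coprime_dvd_mult_right_iff by blast
  then obtain q where q: "m = 2 ^ a * q - 1"
    by (auto elim!: dvdE simp: algebra_simps)
  have "2 * (j * (1 - 2 ^ (a - 1) * q)) = 2 * (2 ^ (b - 1) * t)"
    using m(3) unfolding q pow2_split(1,2) by (simp add: algebra_simps)
  then have "2 ^ (b - 1) dvd j * (1 - 2 ^ (a - 1) * q)"
    by simp
  moreover have "coprime (2 ^ (b - 1)) (1 - 2 ^ (a - 1) * q)"
    using pow2_split(3) by simp
  ultimately have "2 ^ (b - 1) dvd j"
    using coprime_dvd_mult_left_iff by blast
  then obtain p where p: "j = 2 ^ (b - 1) * p" ..
  show ?thesis
  proof (cases "even p")
    case True
    then obtain r where r: "p = 2 * r" by (rule evenE)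
    have "cyc 1 0 = cyc i j"
      by (rule cyc_eqI[of "i + 2 ^ a * r" _ _ "- r" _ _ r])
         (use assms(1) a_ge in \<open>simp_all add: p r pow2_split(2)\<close>)
    then show ?thesis by simp
  next
    case False
    then have "even (p - i)"
      using assms(1) by simp
    then obtain r where r: "p = i + 2 * r"
      by (metis diff_eq_eq add.commute evenE)
    have "cyc 1 (2 ^ (b - 1)) = cyc i j"
      by (rule cyc_eqI[of "i + 2 ^ a * r" _ _ "- r" _ _ "r - 2 ^ (a - 1) * r"])
         (use assms(1) a_ge pow2_split(3) in
           \<open>simp_all add: p r pow2_split(2) algebra_simps\<close>, simp_all add: pow2_split(1))
    then show ?thesis by simp
  qed
qed

text \<open>
  The exponents realising the inversion of \<open>x\<close> on these subgroups are \<open>-1\<close>, \<open>1 + 2\<^sup>b\<close> and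
  \<open>2\<^sup>a - 1\<close>.
\<close>

lemma cyc_fixed:
  "cyc (- 1) 0 = cyc 1 0"
  "cyc (- (2 ^ (a - 1))) 1 = cyc (2 ^ (a - 1)) 1"
  "cyc (- 1) (2 ^ (b - 1)) = cyc 1 (2 ^ (b - 1))"
proof -
  show "cyc (- 1) 0 = cyc 1 0"
    by (rule cyc_eqI[of "-1" _ _ 0 _ _ 0]) simp_all
  show "cyc (- (2 ^ (a - 1))) 1 = cyc (2 ^ (a - 1)) 1"
    by (rule cyc_eqI[of "1 + 2 ^ b" _ _ "1 + 2 ^ (b - 1)" _ _ "-1"])
       (use b_ge pow2_split(4) in \<open>simp_all add: pow2_split(1) algebra_simps\<close>,
         simp_all add: pow2_split(2))
  show "cyc (- 1) (2 ^ (b - 1)) = cyc 1 (2 ^ (b - 1))"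
    by (rule cyc_eqI[of "2 ^ a - 1" _ _ 1 _ _ "1 - 2 ^ (a - 1)"])
       (use a_ge pow2_split(3) in \<open>simp_all add: pow2_split(2) algebra_simps\<close>,
         simp_all add: pow2_split(1))
qed

text \<open>
  The parities of both exponents are invariants of \<open>\<langle>x\<^sup>i y\<^bsup>2j\<^esup>\<rangle>\<close>.  They separate the subgroups here,
  except for two pairs in which one exponent is \<open>0\<close> and the corresponding one is half the modulus.
\<close>

lemma cyc_distinct:
  "cyc 1 0 \<noteq> cyc 0 1" "cyc 1 (2 ^ (b - 1)) \<noteq> cyc 0 1" "cyc (2 ^ (a - 1)) 1 \<noteq> cyc 0 1"
  "cyc 1 0 \<noteq> cyc (2 ^ (a - 1)) 1" "cyc 1 (2 ^ (b - 1)) \<noteq> cyc (2 ^ (a - 1)) 1"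
  "cyc 1 0 \<noteq> cyc 1 (2 ^ (b - 1))"
proof -
  show "cyc 1 0 \<noteq> cyc 0 1"
    using cyc_eq_parity(1)[of 1 0 0 1] by auto
  show "cyc 1 (2 ^ (b - 1)) \<noteq> cyc 0 1"
    using cyc_eq_parity(1)[of 1 "2 ^ (b - 1)" 0 1] by auto
  show "cyc 1 0 \<noteq> cyc (2 ^ (a - 1)) 1"
    using cyc_eq_parity(2)[of 1 0 "2 ^ (a - 1)" 1] by auto
  show "cyc 1 (2 ^ (b - 1)) \<noteq> cyc (2 ^ (a - 1)) 1"
    using cyc_eq_parity(2)[of 1 "2 ^ (b - 1)" "2 ^ (a - 1)" 1] pow2_split(4) by auto
  have "cyc 0 1 \<noteq> cyc (2 ^ (a - 1)) 1"
  proof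
    assume "cyc 0 1 = cyc (2 ^ (a - 1)) 1"
    then obtain s :: int where "2 ^ (a - 1) = 2 ^ a * s"
      unfolding cyc_eq_iff by auto
    then have "2 ^ (a - 1) * 1 = 2 ^ (a - 1) * (2 * s)"
      unfolding pow2_split(1) by simp
    then have "1 = 2 * s"
      by (subst (asm) mult_cancel_left) simp
    then show False by presburger
  qed
  then show "cyc (2 ^ (a - 1)) 1 \<noteq> cyc 0 1"
    by simp
  show "cyc 1 0 \<noteq> cyc 1 (2 ^ (b - 1))"
  proof
    assume "cyc 1 0 = cyc 1 (2 ^ (b - 1))"
    then obtain s :: int where "2 ^ (b - 1) = 2 ^ b * s"
      unfolding cyc_eq_iff by auto
    then have "2 ^ (b - 1) * 1 = 2 ^ (b - 1) * (2 * s)"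
      unfolding pow2_split(2) by simp
    then have "1 = 2 * s"
      by (subst (asm) mult_cancel_left) simp
    then show False by presburger
  qed
qed

lemma fixed_inner:
  "{H \<in> inner_cyclic. conj_y H = H} = {cyc 1 0, cyc (2 ^ (a - 1)) 1, cyc 1 (2 ^ (b - 1))}"
proof (intro equalityI subsetI)
  fix H assume "H \<in> {H \<in> inner_cyclic. conj_y H = H}"
  then have "H \<in> inner_cyclic" and fixed: "conj_y H = H"
    by simp_all
  then obtain i j where H: "H = cyc i j" "odd i \<or> odd j" "cyc i j \<noteq> cyc 0 1"
    unfolding inner_cyclic_eq by blast
  moreover have "cyc (- i) j = cyc i j"
    using fixed unfolding H(1) conj_y_cyc .
  ultimately show "H \<in> {cyc 1 0, cyc (2 ^ (a - 1)) 1, cyc 1 (2 ^ (b - 1))}"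
    using fixed_if_odd_left[of i j] fixed_if_odd_right[of j i] by auto
next
  fix H assume H: "H \<in> {cyc 1 0, cyc (2 ^ (a - 1)) 1, cyc 1 (2 ^ (b - 1))}"
  have "odd (1::int)" by simp
  then have "H \<in> inner_cyclic"
    unfolding inner_cyclic_eq using H cyc_distinct(1-3) by blast
  moreover have "conj_y (cyc 1 0) = cyc 1 0"
    "conj_y (cyc (2 ^ (a - 1)) 1) = cyc (2 ^ (a - 1)) 1"
    "conj_y (cyc 1 (2 ^ (b - 1))) = cyc 1 (2 ^ (b - 1))"
    by (simp_all only: conj_y_cyc cyc_fixed)
  then have "conj_y H = H"
    using H by blast
  ultimately show "H \<in> {H \<in> inner_cyclic. conj_y H = H}"
    by simp
qed

lemma conj_class_inner: "2 * card (conj_class G ` inner_cyclic) = card inner_cyclic + 3"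
proof -
  have eq: "conj_class G ` inner_cyclic = (\<lambda>H. {H, conj_y H}) ` inner_cyclic"
  proof (rule image_cong[OF HOL.refl])
    fix H assume "H \<in> inner_cyclic"
    then obtain i j where "H = cyc i j"
      unfolding inner_cyclic_eq by blast
    then show "conj_class G H = {H, conj_y H}"
      by (simp only: conj_class_cyc conj_y_cyc)
  qed
  have fin: "finite inner_cyclic"
  proof (rule finite_subset)
    show "inner_cyclic \<subseteq> Pow M"
      unfolding inner_cyclic_eq using cyc_subset_M by blast
  qed (simp add: finite_M)
  have "2 * card ((\<lambda>H. {H, conj_y H}) ` inner_cyclic)
      = card inner_cyclic + card {H \<in> inner_cyclic. conj_y H = H}"
  proof (rule card_orbits_involution[OF fin])
    fix H assume "H \<in> inner_cyclic"
    then obtain i j where H: "H = cyc i j" "odd i \<or> odd j" "cyc i j \<noteq> cyc 0 1"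
      unfolding inner_cyclic_eq by blast
    show "conj_y (conj_y H) = H"
      by (simp add: H(1) conj_y_cyc)
    have "conj_y (cyc (- i) j) = cyc i j" "conj_y (cyc 0 1) = cyc 0 1"
      by (simp_all only: conj_y_cyc minus_minus minus_zero)
    then have "cyc (- i) j \<noteq> cyc 0 1"
      using H(3) by metis
    moreover have "odd (- i) \<or> odd j"
      using H(2) by simp
    ultimately show "conj_y H \<in> inner_cyclic"
      unfolding H(1) conj_y_cyc inner_cyclic_eq by blast
  qed
  also have "card {H \<in> inner_cyclic. conj_y H = H} = 3"
    unfolding fixed_inner using cyc_distinct by simp
  finally show ?thesis
    unfolding eq .
qed

text \<open>
  The two classes outside \<open>M\<close> and the \<open>(n - 1 + 3) / 2\<close> classes inside, where \<open>n\<close> is the number of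
  maximal cyclic subgroups of \<open>M\<close>, are disjoint because \<open>M\<close> is normal.
\<close>

lemma eta_G: "2 * eta G = eta (G\<lparr>carrier := M\<rparr>) + 6"
proof -
  have "odd (1::int)" by simp
  then have mem: "cyc 0 1 \<in> maximal_cyclic_subgroups (G\<lparr>carrier := M\<rparr>)"
    unfolding maximal_cyclic_subgroups_M by blast
  have finM: "finite (maximal_cyclic_subgroups (G\<lparr>carrier := M\<rparr>))"
  proof (rule finite_subset)
    show "maximal_cyclic_subgroups (G\<lparr>carrier := M\<rparr>) \<subseteq> Pow M"
      unfolding maximal_cyclic_subgroups_M using cyc_subset_M by blast
  qed (simp add: finite_M)
  have inner: "card inner_cyclic + 1 = eta (G\<lparr>carrier := M\<rparr>)"
    unfolding inner_cyclic_def eta_M_eq_card using card_Suc_Diff1[OF finM mem] by (simp only: Suc_eq_plus1)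
  have fin: "finite inner_cyclic"
    unfolding inner_cyclic_def using finM by simp
  have "conj_class G ` outer_cyclic \<inter> conj_class G ` inner_cyclic = {}"
  proof -
    have "\<Union> (conj_class G H) \<subseteq> M" if "H \<in> inner_cyclic" for H
    proof -
      obtain i j where "H = cyc i j"
        using \<open>H \<in> inner_cyclic\<close> unfolding inner_cyclic_eq by blast
      then show ?thesis
        using cyc_subset_M by (simp add: conj_class_cyc)
    qed
    moreover have "\<not> \<Union> (conj_class G H) \<subseteq> M" if "H \<in> outer_cyclic" for H
    proof -
      obtain i where i: "H = generate G {el i 1}"
        using \<open>H \<in> outer_cyclic\<close> unfolding outer_cyclic_def by blast
      have "H \<in> conj_class G H"
        unfolding i by (rule self_in_conj_class) (simp add: generate_incl)
      moreover have "el i 1 \<in> H"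
        unfolding i by (simp add: generate.incl)
      moreover have "el i 1 \<notin> M"
        by (simp add: el_mem_M_iff)
      ultimately show ?thesis by blast
    qed
    ultimately show ?thesis by blast
  qed
  moreover have "finite (conj_class G ` outer_cyclic)"
    using conj_class_outer by (simp add: card_ge_0_finite)
  ultimately have "eta G = 2 + card (conj_class G ` inner_cyclic)"
    unfolding eta_def maximal_cyclic_subgroups_G image_Un
    using fin by (simp add: card_Un_disjoint conj_class_outer)
  then show ?thesis
    using conj_class_inner inner by simp
qed

end

section \<open>The presented group\<close>

text \<open>
  The first coordinate of a word in the semidirect product \<open>\<int> \<rtimes> \<int>\<close> in which \<open>y\<close> acts on
  \<open>\<langle>x\<rangle>\<close> by inversion: moving a letter \<open>y\<close> from the front of a word to its end changes the sign of the
  exponent of \<open>x\<close>.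
\<close>

fun x_exponent :: "xy word \<Rightarrow> int" where
  "x_exponent [] = 0"
| "x_exponent ((Gx, p) # w) = (if p then 1 else - 1) + x_exponent w"
| "x_exponent ((Gy, p) # w) = - x_exponent w"

fun y_exponent :: "xy word \<Rightarrow> int" where
  "y_exponent [] = 0"
| "y_exponent ((Gx, p) # w) = y_exponent w"
| "y_exponent ((Gy, p) # w) = (if p then 1 else - 1) + y_exponent w"

lemma y_exponent_append: "y_exponent (u @ v) = y_exponent u + y_exponent v"
  by (induction u rule: y_exponent.induct) auto

lemma x_exponent_append:
  "x_exponent (u @ v) = x_exponent u + (if even (y_exponent u) then x_exponent v else - x_exponent v)"
  by (induction u rule: x_exponent.induct) auto

lemma exponents_replicate:
  "x_exponent (replicate n (Gx, p)) = (if p then int n else - int n)"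
  "y_exponent (replicate n (Gx, p)) = 0"
  "x_exponent (replicate n (Gy, p)) = 0"
  "y_exponent (replicate n (Gy, p)) = (if p then int n else - int n)"
  by (induction n) auto

lemma word_pow_gen: "word_pow (gen g) n = replicate n (g, True)"
  unfolding word_pow_def gen_def by (induction n) auto

text \<open>
  The lattice of pairs \<open>(2\<^sup>a s, 2\<^bsup>b+1\<^esup> t)\<close> with \<open>s + t\<close> even contains the three relators and is
  compatible with concatenation: its second coordinates are even, so equivalent words act on \<open>x\<close> with the
  same sign, and a change of sign of \<open>s\<close> does not affect the parity of \<open>s + t\<close>.  This bounds the group
  from below without constructing a model of it.
\<close>

lemma exponents_word_eq:
  assumes "word_eq (G2_neg_relations (a + 1) (b + 1) 1 0) u v"
  shows "\<exists>s t. x_exponent u - x_exponent v = 2 ^ a * s \<and>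
    y_exponent u - y_exponent v = 2 ^ (b + 1) * t \<and> even (s + t)"
  using assms
proof (induction rule: word_eq.induct)
  case (refl u)
  show ?case by (rule exI[of _ 0], rule exI[of _ 0]) simp
next
  case (sym u v)
  then obtain s t where "x_exponent u - x_exponent v = 2 ^ a * s"
    "y_exponent u - y_exponent v = 2 ^ (b + 1) * t" "even (s + t)"
    by blast
  then show ?case
    by - (rule exI[of _ "- s"], rule exI[of _ "- t"], simp add: algebra_simps)
next
  case (trans u v w)
  then obtain s t s' t' where "x_exponent u - x_exponent v = 2 ^ a * s"
    "y_exponent u - y_exponent v = 2 ^ (b + 1) * t" "even (s + t)"
    "x_exponent v - x_exponent w = 2 ^ a * s'"
    "y_exponent v - y_exponent w = 2 ^ (b + 1) * t'" "even (s' + t')"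
    by blast
  then show ?case
    by - (rule exI[of _ "s + s'"], rule exI[of _ "t + t'"], auto simp: algebra_simps)
next
  case (append u u' v v')
  then obtain s t s' t' where st: "x_exponent u - x_exponent u' = 2 ^ a * s"
    "y_exponent u - y_exponent u' = 2 ^ (b + 1) * t" "even (s + t)"
    "x_exponent v - x_exponent v' = 2 ^ a * s'"
    "y_exponent v - y_exponent v' = 2 ^ (b + 1) * t'" "even (s' + t')"
    by blast
  \<comment> \<open>Both words must act on \<open>x\<close> with the same sign \<open>\<sigma>\<close>.\<close>
  have "even (y_exponent u - y_exponent u')"
    unfolding st(2) by simp
  then have parity: "even (y_exponent u) \<longleftrightarrow> even (y_exponent u')"
    by auto
  define \<sigma> :: int where "\<sigma> = (if even (y_exponent u) then 1 else - 1)"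
  have "x_exponent (u @ v) - x_exponent (u' @ v') =
      (x_exponent u - x_exponent u') + \<sigma> * (x_exponent v - x_exponent v')"
    using parity by (auto simp: x_exponent_append \<sigma>_def)
  then have "x_exponent (u @ v) - x_exponent (u' @ v') = 2 ^ a * (s + \<sigma> * s')"
    unfolding st by (simp add: algebra_simps)
  moreover have "y_exponent (u @ v) - y_exponent (u' @ v') = 2 ^ (b + 1) * (t + t')"
    using st(2,5) by (simp add: y_exponent_append algebra_simps)
  moreover have "even ((s + \<sigma> * s') + (t + t'))"
    using st(3,6) by (auto simp: \<sigma>_def)
  ultimately show ?case by blast
next
  case (cancel g p)
  show ?case by (rule exI[of _ 0], rule exI[of _ 0]) (cases g; simp)
next
  case (relation u v)
  then consider
    "u = word_pow (gen Gx) (2 ^ (a + 1))" "v = []"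
    | "u = word_pow (gen Gy) (2 ^ (b + 1))" "v = word_pow (gen Gx) (2 ^ a)"
    | "u = gen_inv Gy @ gen Gx @ gen Gy" "v = word_pow (gen Gx) (2 ^ (a + 1) - 1)"
    unfolding G2_neg_relations_def by auto
  then show ?case
  proof cases
    case 1
    then show ?thesis
      by - (rule exI[of _ 2], rule exI[of _ 0], simp add: word_pow_gen exponents_replicate)
  next
    case 2
    then show ?thesis
      by - (rule exI[of _ "- 1"], rule exI[of _ 1], simp add: word_pow_gen exponents_replicate)
  next
    case 3
    have "x_exponent u = - 1" "y_exponent u = 0"
      using 3(1) by (simp_all add: gen_def gen_inv_def)
    moreover have "x_exponent v = 2 ^ (a + 1) - 1" "y_exponent v = 0"
      unfolding 3(2) word_pow_gen exponents_replicate by (simp_all add: of_nat_diff)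
    ultimately show ?thesis
      by - (rule exI[of _ "- 2"], rule exI[of _ 0], simp)
  qed
qed

lemma word_class_word_pow:
  "word_class R (word_pow w n) = word_class R w [^]\<^bsub>presented_group R\<^esub> n"
proof -
  interpret group "presented_group R" by (rule group_presented_group)
  have c: "word_class R w \<in> carrier (presented_group R)"
    by (simp add: carrier_presented_group)
  have "word_class R w \<otimes>\<^bsub>presented_group R\<^esub> word_class R w [^]\<^bsub>presented_group R\<^esub> n
      = word_class R w [^]\<^bsub>presented_group R\<^esub> Suc n" for n
    by (rule nat_pow_Suc2[OF c, symmetric])
  then show ?thesis
    by (induction n) (simp_all add: word_pow_def one_presented_group flip: mult_presented_group)
qed

lemma word_class_gen_inv:
  "word_class R (gen_inv g) = inv\<^bsub>presented_group R\<^esub> word_class R (gen g)"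
proof -
  interpret group "presented_group R" by (rule group_presented_group)
  have "word_class R (gen_inv g) \<otimes>\<^bsub>presented_group R\<^esub> word_class R (gen g) = \<one>\<^bsub>presented_group R\<^esub>"
    using word_eq.cancel[of R g False]
    by (simp add: mult_presented_group one_presented_group word_class_eq_iff gen_inv_def gen_def)
  then show ?thesis
    by (intro inv_equality[symmetric]) (simp_all add: carrier_presented_group)
qed

lemma word_class_replicate:
  "word_class R (replicate (nat \<bar>i\<bar>) (g, i \<ge> 0)) = word_class R (gen g) [^]\<^bsub>presented_group R\<^esub> (i :: int)"
proof -
  interpret group "presented_group R" by (rule group_presented_group)
  have c: "word_class R (gen g) \<in> carrier (presented_group R)"
    by (simp add: carrier_presented_group)
  have rep: "replicate n l = word_pow [l] n" for n and l :: "'a \<times> bool"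
    unfolding word_pow_def by (induction n) auto
  have inv: "word_class R [(g, False)] = inv\<^bsub>presented_group R\<^esub> word_class R (gen g)"
    using word_class_gen_inv[of R g] by (simp add: gen_inv_def)
  show ?thesis
  proof (cases "i \<ge> 0")
    case True
    then obtain n where i: "i = int n"
      by (rule nonneg_int_cases)
    have "replicate (nat \<bar>i\<bar>) (g, i \<ge> 0) = word_pow (gen g) n"
      by (simp add: i rep gen_def)
    then show ?thesis
      by (simp only: word_class_word_pow i int_pow_int)
  next
    case False
    then obtain n where i: "i = - int n" "n > 0"
      by (metis int_cases2 neg_0_equal_iff_equal not_gr0 of_nat_0 of_nat_0_le_iff)
    have "replicate (nat \<bar>i\<bar>) (g, i \<ge> 0) = word_pow [(g, False)] n"
      using i(2) by (simp add: i(1) rep)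
    then show ?thesis
      by (simp only: word_class_word_pow inv i(1) int_pow_neg_int[OF c] nat_pow_inv[OF c])
  qed
qed

text \<open>
  Spanning follows by moving letters \<open>y\<close> past powers of \<open>x\<close>.  For the triviality criterion, the
  exponents of the word \<open>x\<^sup>i y\<^sup>j\<close> are \<open>(i, j)\<close>, so \<open>exponents_word_eq\<close> gives one direction; for the
  other, the relations turn \<open>x\<^sup>i y\<^sup>j\<close> into \<open>x\<^sup>m\<close> with \<open>m = 2\<^sup>a (s + t)\<close>.
\<close>

lemma neg_metacyclic_G2_neg:
  assumes "2 \<le> a" "2 \<le> b"
  shows "neg_metacyclic (G2_neg (a + 1) (b + 1) 1 0) (G2_neg_x (a + 1) (b + 1) 1 0)
    (G2_neg_y (a + 1) (b + 1) 1 0) a b"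
proof -
  define R where "R = G2_neg_relations (a + 1) (b + 1) 1 0"
  define x where "x = word_class R (gen Gx)"
  define y where "y = word_class R (gen Gy)"
  let ?P = "presented_group R"
  interpret group ?P by (rule group_presented_group)
  have x [simp]: "x \<in> carrier ?P" and y [simp]: "y \<in> carrier ?P"
    by (simp_all add: x_def y_def carrier_presented_group)
  have x_order: "x [^]\<^bsub>?P\<^esub> (2 ^ (a + 1) :: nat) = \<one>\<^bsub>?P\<^esub>"
    unfolding x_def word_class_word_pow[symmetric] one_presented_group word_class_eq_iff
    by (rule word_eq.relation) (simp add: R_def G2_neg_relations_def)
  have y_pow: "y [^]\<^bsub>?P\<^esub> (2 ^ (b + 1) :: nat) = x [^]\<^bsub>?P\<^esub> (2 ^ a :: nat)"
    unfolding x_def y_def word_class_word_pow[symmetric] word_class_eq_iff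
    by (rule word_eq.relation) (simp add: R_def G2_neg_relations_def)
  have "inv\<^bsub>?P\<^esub> y \<otimes>\<^bsub>?P\<^esub> x \<otimes>\<^bsub>?P\<^esub> y = x [^]\<^bsub>?P\<^esub> (2 ^ (a + 1) - 1 :: nat)"
    unfolding x_def y_def word_class_word_pow[symmetric] word_class_gen_inv[symmetric]
      mult_presented_group word_class_eq_iff
    by (rule word_eq.relation) (simp add: R_def G2_neg_relations_def)
  moreover have "x [^]\<^bsub>?P\<^esub> (2 ^ (a + 1) - 1 :: nat) \<otimes>\<^bsub>?P\<^esub> x = \<one>\<^bsub>?P\<^esub>"
    using nat_pow_Suc[of x "2 ^ (a + 1) - 1"] x_order by simp
  ultimately have inverts: "inv\<^bsub>?P\<^esub> y \<otimes>\<^bsub>?P\<^esub> x \<otimes>\<^bsub>?P\<^esub> y = inv\<^bsub>?P\<^esub> x"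
    using inv_equality by simp
  have normal: "\<exists>i j. A = x [^]\<^bsub>?P\<^esub> (i::int) \<otimes>\<^bsub>?P\<^esub> y [^]\<^bsub>?P\<^esub> (j::int)"
    if "A \<in> carrier ?P" for A
  proof -
    note yx = inverting_element_int_pow[OF inverts x y]
    have "\<exists>i j. word_class R w = x [^]\<^bsub>?P\<^esub> (i::int) \<otimes>\<^bsub>?P\<^esub> y [^]\<^bsub>?P\<^esub> (j::int)" for w
    proof (induction w)
      case Nil
      have "word_class R [] = x [^]\<^bsub>?P\<^esub> (0::int) \<otimes>\<^bsub>?P\<^esub> y [^]\<^bsub>?P\<^esub> (0::int)"
        by (simp flip: one_presented_group)
      then show ?case by blast
    next
      case (Cons l w)
      then obtain i j :: int where ij: "word_class R w = x [^]\<^bsub>?P\<^esub> i \<otimes>\<^bsub>?P\<^esub> y [^]\<^bsub>?P\<^esub> j"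
        by blast
      have step: "word_class R (l # w) = word_class R [l] \<otimes>\<^bsub>?P\<^esub> word_class R w" for l
        by (simp add: mult_presented_group)
      have letters: "word_class R [(Gx, True)] = x" "word_class R [(Gx, False)] = inv\<^bsub>?P\<^esub> x"
        "word_class R [(Gy, True)] = y" "word_class R [(Gy, False)] = inv\<^bsub>?P\<^esub> y"
        using word_class_gen_inv[of R] by (simp_all add: x_def y_def gen_def gen_inv_def)
      consider "l = (Gx, True)" | "l = (Gx, False)" | "l = (Gy, True)" | "l = (Gy, False)"
        by (cases l; cases "fst l"; cases "snd l") auto
      then show ?case
      proof cases
        case 1
        then have "word_class R (l # w) = x [^]\<^bsub>?P\<^esub> (1 + i) \<otimes>\<^bsub>?P\<^esub> y [^]\<^bsub>?P\<^esub> j"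
          by (simp add: step letters ij int_pow_mult m_assoc)
        then show ?thesis by blast
      next
        case 2
        then have "word_class R (l # w) = x [^]\<^bsub>?P\<^esub> (- 1 + i) \<otimes>\<^bsub>?P\<^esub> y [^]\<^bsub>?P\<^esub> j"
          by (simp add: step letters ij int_pow_diff int_pow_mult int_pow_neg m_assoc del: add_uminus_conv_diff uminus_add_conv_diff)
        then show ?thesis by blast
      next
        case 3
        then have "word_class R (l # w) = (y \<otimes>\<^bsub>?P\<^esub> x [^]\<^bsub>?P\<^esub> i) \<otimes>\<^bsub>?P\<^esub> y [^]\<^bsub>?P\<^esub> j"
          by (simp add: step letters ij m_assoc)
        also have "\<dots> = x [^]\<^bsub>?P\<^esub> (- i) \<otimes>\<^bsub>?P\<^esub> y [^]\<^bsub>?P\<^esub> (1 + j)"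
          by (simp add: yx int_pow_mult m_assoc)
        finally show ?thesis by blast
      next
        case 4
        then have "word_class R (l # w) = (inv\<^bsub>?P\<^esub> y \<otimes>\<^bsub>?P\<^esub> x [^]\<^bsub>?P\<^esub> i) \<otimes>\<^bsub>?P\<^esub> y [^]\<^bsub>?P\<^esub> j"
          by (simp add: step letters ij m_assoc)
        also have "\<dots> = x [^]\<^bsub>?P\<^esub> (- i) \<otimes>\<^bsub>?P\<^esub> y [^]\<^bsub>?P\<^esub> (- 1 + j)"
          unfolding yx by (simp add: int_pow_mult int_pow_neg m_assoc del: add_uminus_conv_diff uminus_add_conv_diff)
        finally show ?thesis by blast
      qed
    qed
    then show ?thesis
      using that by (auto simp: carrier_presented_group)
  qed
  have trivial_iff: "x [^]\<^bsub>?P\<^esub> i \<otimes>\<^bsub>?P\<^esub> y [^]\<^bsub>?P\<^esub> j = \<one>\<^bsub>?P\<^esub> \<longleftrightarrow>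
      (\<exists>s t. i = 2 ^ a * s \<and> j = 2 ^ (b + 1) * t \<and> even (s + t))" for i j :: int
  proof
    let ?w = "replicate (nat \<bar>i\<bar>) (Gx, i \<ge> 0) @ replicate (nat \<bar>j\<bar>) (Gy, j \<ge> 0)"
    assume "x [^]\<^bsub>?P\<^esub> i \<otimes>\<^bsub>?P\<^esub> y [^]\<^bsub>?P\<^esub> j = \<one>\<^bsub>?P\<^esub>"
    then have "word_eq R ?w []"
      by (simp only: x_def y_def word_class_replicate[symmetric] mult_presented_group
          one_presented_group word_class_eq_iff)
    moreover have "x_exponent ?w = i" "y_exponent ?w = j"
      by (simp_all add: x_exponent_append y_exponent_append exponents_replicate)
    ultimately show "\<exists>s t. i = 2 ^ a * s \<and> j = 2 ^ (b + 1) * t \<and> even (s + t)"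
      using exponents_word_eq[of a b ?w "[]"] by (simp add: R_def)
  next
    assume "\<exists>s t. i = 2 ^ a * s \<and> j = 2 ^ (b + 1) * t \<and> even (s + t)"
    then obtain s t where ij: "i = 2 ^ a * s" "j = 2 ^ (b + 1) * t" and "even (s + t)"
      by blast
    then obtain h where h: "s + t = 2 * h"
      by (blast elim: evenE)
    note st = ij h
    have "y [^]\<^bsub>?P\<^esub> j = (y [^]\<^bsub>?P\<^esub> int (2 ^ (b + 1))) [^]\<^bsub>?P\<^esub> t"
      by (simp add: st int_pow_pow)
    also have "\<dots> = (x [^]\<^bsub>?P\<^esub> int (2 ^ a)) [^]\<^bsub>?P\<^esub> t"
      by (simp only: int_pow_int y_pow)
    also have "\<dots> = x [^]\<^bsub>?P\<^esub> (2 ^ a * t)"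
      by (simp add: int_pow_pow)
    finally have "x [^]\<^bsub>?P\<^esub> i \<otimes>\<^bsub>?P\<^esub> y [^]\<^bsub>?P\<^esub> j = x [^]\<^bsub>?P\<^esub> (2 ^ a * (s + t))"
      by (simp add: st(1) int_pow_mult distrib_left)
    also have "\<dots> = (x [^]\<^bsub>?P\<^esub> int (2 ^ (a + 1))) [^]\<^bsub>?P\<^esub> h"
      unfolding st(3) by (simp add: int_pow_pow mult.assoc mult.left_commute)
    also have "\<dots> = \<one>\<^bsub>?P\<^esub>"
      by (simp only: int_pow_int x_order int_pow_one)
    finally show "x [^]\<^bsub>?P\<^esub> i \<otimes>\<^bsub>?P\<^esub> y [^]\<^bsub>?P\<^esub> j = \<one>\<^bsub>?P\<^esub>" .
  qed
  have "neg_metacyclic ?P x y a b"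
    by unfold_locales (use assms inverts normal trivial_iff in auto)
  then show ?thesis
    by (simp only: G2_neg_def G2_neg_x_def G2_neg_y_def R_def x_def y_def)
qed

theorem theorem4p8:
  fixes \<alpha> \<beta> :: nat
    and G :: "xy word set monoid"
    and x y :: "xy word set"
    and M :: "xy word set set"
  assumes "\<alpha> \<ge> 3" and "\<beta> \<ge> 3"
    and "G = G2_neg \<alpha> \<beta> 1 0"
    and "x = G2_neg_x \<alpha> \<beta> 1 0" and "y = G2_neg_y \<alpha> \<beta> 1 0"
    and "M = generate G {x, y [^]\<^bsub>G\<^esub> (2::nat)}"
  shows "(\<alpha> \<ge> \<beta> \<longrightarrow>
            real (eta G) = real (eta (G\<lparr>carrier := M\<rparr>)) / 2 + 3 \<and>
            real (eta (G\<lparr>carrier := M\<rparr>)) / 2 + 3 = real (g2 \<alpha> (\<beta> - 1)) / 2 + 3) \<and>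
         (\<alpha> < \<beta> \<longrightarrow>
            real (eta G) = real (eta (G\<lparr>carrier := M\<rparr>)) / 2 + 3 \<and>
            real (eta (G\<lparr>carrier := M\<rparr>)) / 2 + 3 = real (g2 (\<alpha> - 1) \<beta>) / 2 + 3)"
proof -
  define a b where "a = \<alpha> - 1" and "b = \<beta> - 1"
  have ab: "\<alpha> = a + 1" "\<beta> = b + 1" "2 \<le> a" "2 \<le> b"
    using assms(1,2) by (simp_all add: a_def b_def)
  have "neg_metacyclic G x y a b"
    using neg_metacyclic_G2_neg[OF ab(3,4)] unfolding assms(3-5) ab(1,2) .
  then interpret N: neg_metacyclic G x y a b .
  have M: "M = N.M"
    unfolding assms(6) N.M_def ..
  have "real (2 * eta G) = real (eta (G\<lparr>carrier := M\<rparr>) + 6)"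
    unfolding M N.eta_G ..
  then have "real (eta G) = real (eta (G\<lparr>carrier := M\<rparr>)) / 2 + 3"
    by simp
  moreover have "eta (G\<lparr>carrier := M\<rparr>) = g2 \<alpha> (\<beta> - 1)" if "\<alpha> \<ge> \<beta>"
    using N.eta_M(1) that by (simp add: M ab(1,2))
  moreover have "eta (G\<lparr>carrier := M\<rparr>) = g2 (\<alpha> - 1) \<beta>" if "\<alpha> < \<beta>"
    using N.eta_M(2) that by (simp add: M ab(1,2))
  ultimately show ?thesis
    by simp
qed

end
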